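(* Let $V_1\xrightarrow{\phi_1}V_2\xrightarrow{\phi_2}V_3\xrightarrow{\phi_3}\cdots$ be an inductive system in the category $\mathbf{AOU}$ of Archimedean order unit spaces and unital positive linear maps, such that each $\phi_k$ is a unital order embedding. Then $\mathrm{OMIN}(\varinjlim_{\mathbf{AOU}}V_k)$ is unitally completely order isomorphic to $\varinjlim_{\mathbf{OS}}\mathrm{OMIN}(V_k)$, where the latter is the inductive limit of the system $\mathrm{OMIN}(V_1)\xrightarrow{\phi_1}\mathrm{OMIN}(V_2)\xrightarrow{\phi_2}\cdots$ in the category of operator systems.
   Context: An Archimedean order unit (AOU) space is a complex $*$-vector space $V$ with a cone $V^+\subseteq V_h$, $V^+\cap(-V^+)=\{0\}$, and an order unit $e\in V^+$ (for every $x\in V_h$ there is $r>0$ with $re-x\in V^+$) that is Archimedean: $V^+=\{x\in V_h:re+x\in V^+\ \forall r>0\}$. A unital order embedding is a unital injective linear map $\phi$ with $v\in V^+$ if and only if $\phi(v)\in W^+$. An operator system (not assumed complete) is a matrix ordered $*$-vector space with an Archimedean matrix order unit; $\mathbf{OS}$ is the category of operator systems and unital completely positive maps. A unital complete order isomorphism is a unital linear bijection, completely positive with completely positive inverse. $\mathrm{OMIN}(V)$ is the operator system with underlying AOU space $V$ and matrix cones $C_n^{\min}(V)=\{(x_{i,j})\in M_n(V):\sum_{i,j=1}^n\overline{\lambda_i}\lambda_jx_{i,j}\in V^+\ \forall\lambda_1,\dots,\lambda_n\in\mathbb{C}\}$. A unital positive map $V\to W$ is completely positive as a map $\mathrm{OMIN}(V)\to\mathrm{OMIN}(W)$,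 so $\mathrm{OMIN}(V_1)\xrightarrow{\phi_1}\mathrm{OMIN}(V_2)\xrightarrow{\phi_2}\cdots$ is an inductive system in $\mathbf{OS}$. The inductive limit of a system $(\{A_k\},\{\alpha_k\})$ in a category is an object $A$ with morphisms $\alpha_{k,\infty}:A_k\to A$, $\alpha_{k+1,\infty}\circ\alpha_k=\alpha_{k,\infty}$, universal with this property. Inductive limits exist in both $\mathbf{AOU}$ and $\mathbf{OS}$ and are unique up to isomorphism. *)

theory Defs
  imports
    "Jordan_Normal_Form.VS_Connect"
begin

text \<open>
  Spaces are carrier-based, in the style of HOL-Algebra, because the members of an inductive
  system are different spaces. The fields \<open>mult\<close> and \<open>one\<close> that every HOL-Algebra module
  record inherits from \<open>ring\<close> carry no meaning; the order unit has its own field.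
\<close>

section \<open>Archimedean order unit spaces\<close>

record 'a star_space = "(complex, 'a) module" +
  star :: "'a \<Rightarrow> 'a"
  ounit :: 'a

record 'a aou_space = "'a star_space" +
  pcone :: "'a set"

locale star_space =
  vectorspace "class_ring :: complex ring" V
  for V :: "('a, 'm) star_space_scheme" (structure) +
  assumes star_closed: "x \<in> carrier V \<Longrightarrow> star V x \<in> carrier V"
    and star_star: "x \<in> carrier V \<Longrightarrow> star V (star V x) = x"
    and star_add: "\<lbrakk>x \<in> carrier V; y \<in> carrier V\<rbrakk> \<Longrightarrow> star V (x \<oplus> y) = star V x \<oplus> star V y"
    and star_smult: "x \<in> carrier V \<Longrightarrow> star V (c \<odot>\<^bsub>V\<^esub> x) = cnj c \<odot>\<^bsub>V\<^esub> star V x"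

definition hermitian :: "('a, 'm) star_space_scheme \<Rightarrow> 'a set" where
  "hermitian V = {x \<in> carrier V. star V x = x}"

locale aou_space = star_space V
  for V :: "'a aou_space" (structure) +
  assumes pcone_hermitian: "pcone V \<subseteq> hermitian V"
    and pcone_add: "\<lbrakk>x \<in> pcone V; y \<in> pcone V\<rbrakk> \<Longrightarrow> x \<oplus> y \<in> pcone V"
    and pcone_smult: "\<lbrakk>(0::real) \<le> r; x \<in> pcone V\<rbrakk> \<Longrightarrow> complex_of_real r \<odot>\<^bsub>V\<^esub> x \<in> pcone V"
    and pcone_proper: "pcone V \<inter> (\<lambda>x. \<ominus> x) ` pcone V = {\<zero>}"
    and ounit_pcone: "ounit V \<in> pcone V"
    and order_unit:
      "x \<in> hermitian V \<Longrightarrow> \<exists>r>0. (complex_of_real r \<odot>\<^bsub>V\<^esub> ounit V) \<ominus> x \<in> pcone V"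
    and archimedean:
      "pcone V = {x \<in> hermitian V. \<forall>r>0. (complex_of_real r \<odot>\<^bsub>V\<^esub> ounit V) \<oplus> x \<in> pcone V}"

definition unital_linear ::
  "('a, 'm) star_space_scheme \<Rightarrow> ('b, 'n) star_space_scheme \<Rightarrow> ('a \<Rightarrow> 'b) \<Rightarrow> bool" where
  "unital_linear V W f \<longleftrightarrow>
     f \<in> LinearCombinations.module_hom (class_ring :: complex ring) V W \<and>
     f (ounit V) = ounit W"

definition unital_positive :: "'a aou_space \<Rightarrow> 'b aou_space \<Rightarrow> ('a \<Rightarrow> 'b) \<Rightarrow> bool" where
  "unital_positive V W f \<longleftrightarrow> unital_linear V W f \<and> (\<forall>v\<in>pcone V. f v \<in> pcone W)"

definition unital_order_embedding :: "'a aou_space \<Rightarrow> 'b aou_space \<Rightarrow> ('a \<Rightarrow> 'b) \<Rightarrow> bool" where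
  "unital_order_embedding V W f \<longleftrightarrow>
     unital_linear V W f \<and> inj_on f (carrier V) \<and>
     (\<forall>v\<in>carrier V. v \<in> pcone V \<longleftrightarrow> f v \<in> pcone W)"

section \<open>Operator systems\<close>

text \<open>\<open>mcone A n\<close> is the cone in $M_n(A)$; only the values at \<open>n \<ge> 1\<close> are significant.\<close>

record 'a op_system = "'a star_space" +
  mcone :: "nat \<Rightarrow> 'a mat set"

definition mat_over :: "('a, 'm) star_space_scheme \<Rightarrow> nat \<Rightarrow> 'a mat set" where
  "mat_over V n = {M \<in> carrier_mat n n. elements_mat M \<subseteq> carrier V}"

text \<open>$M_n(A)$ as an ordered \<open>*\<close>-vector space with cone $C_n$ and unit $\mathrm{diag}(e,\dots,e)$.\<close>

definition matrix_level :: "'a op_system \<Rightarrow> nat \<Rightarrow> 'a mat aou_space" where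
  "matrix_level A n =
     \<lparr>carrier = mat_over A n,
      mult = undefined,
      one = undefined,
      zero = mat n n (\<lambda>_. \<zero>\<^bsub>A\<^esub>),
      add = (\<lambda>M N. mat n n (\<lambda>ij. M $$ ij \<oplus>\<^bsub>A\<^esub> N $$ ij)),
      smult = (\<lambda>c M. mat n n (\<lambda>ij. c \<odot>\<^bsub>A\<^esub> M $$ ij)),
      star = (\<lambda>M. mat n n (\<lambda>(i, j). star A (M $$ (j, i)))),
      ounit = mat n n (\<lambda>(i, j). if i = j then ounit A else \<zero>\<^bsub>A\<^esub>),
      pcone = mcone A n\<rparr>"

text \<open>The compression $\alpha^* M \alpha \in M_m(A)$ of $M \in M_n(A)$ by $\alpha \in M_{n,m}(\mathbb{C})$.\<close>

definition compress ::
  "('a, 'm) star_space_scheme \<Rightarrow> nat \<Rightarrow> nat \<Rightarrow> complex mat \<Rightarrow> 'a mat \<Rightarrow> 'a mat" where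
  "compress V n m \<alpha> M = mat m m (\<lambda>(p, q).
     finsum V (\<lambda>(i, j). (cnj (\<alpha> $$ (i, p)) * \<alpha> $$ (j, q)) \<odot>\<^bsub>V\<^esub> M $$ (i, j)) ({..<n} \<times> {..<n}))"

text \<open>
  The assumption \<open>levels\<close> says that the $C_n$ are proper cones of hermitian matrices and that
  the order unit is an Archimedean matrix order unit.
\<close>

locale op_system = star_space A
  for A :: "'a op_system" (structure) +
  assumes ounit_closed: "ounit A \<in> carrier A"
    and levels: "n > 0 \<Longrightarrow> aou_space (matrix_level A n)"
    and compress_closed:
      "\<lbrakk>n > 0; m > 0; \<alpha> \<in> carrier_mat n m; M \<in> mcone A n\<rbrakk> \<Longrightarrow> compress A n m \<alpha> M \<in> mcone A m"

definition ucp :: "'a op_system \<Rightarrow> 'b op_system \<Rightarrow> ('a \<Rightarrow> 'b) \<Rightarrow> bool" where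
  "ucp A B f \<longleftrightarrow>
     unital_linear A B f \<and> (\<forall>n>0. \<forall>M\<in>mcone A n. map_mat f M \<in> mcone B n)"

definition unitally_completely_order_isomorphic :: "'a op_system \<Rightarrow> 'b op_system \<Rightarrow> bool" where
  "unitally_completely_order_isomorphic A B \<longleftrightarrow>
     (\<exists>f. bij_betw f (carrier A) (carrier B) \<and> ucp A B f \<and> ucp B A (inv_into (carrier A) f))"

definition OMIN :: "'a aou_space \<Rightarrow> 'a op_system" where
  "OMIN V =
     \<lparr>carrier = carrier V, mult = mult V, one = one V, zero = zero V, add = add V,
      smult = smult V, star = star V, ounit = ounit V,
      mcone = (\<lambda>n. {M \<in> mat_over V n. \<forall>c :: nat \<Rightarrow> complex.
        finsum V (\<lambda>(i, j). (cnj (c i) * c j) \<odot>\<^bsub>V\<^esub> M $$ (i, j)) ({..<n} \<times> {..<n}) \<in> pcone V})\<rparr>"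

section \<open>Inductive limits\<close>

text \<open>
  A category of structured sets is given by predicates \<open>obj\<close> for its objects and
  \<open>mor A B f\<close> for its morphisms. A morphism matters only on the carrier of its domain, so
  equality of morphisms is equality there. Systems are indexed from 0.

  The type \<open>'a\<close> of elements is the universe of the category: the universal property ranges over
  all objects with carrier in \<open>'a\<close>. Since \<open>'a\<close> is arbitrary, this is no restriction on the
  spaces. It does not affect which objects are limits either: up to isomorphism the limit lives on
  a quotient of the disjoint union of the carriers of the system, and this fits into every
  infinite \<open>'a\<close>, while over a finite \<open>'a\<close> all complex vector spaces are zero.
\<close>

definition inductive_system ::
  "(('a, 'm) partial_object_scheme \<Rightarrow> bool) \<Rightarrow>
   (('a, 'm) partial_object_scheme \<Rightarrow> ('a, 'm) partial_object_scheme \<Rightarrow> ('a \<Rightarrow> 'a) \<Rightarrow> bool) \<Rightarrow>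
   (nat \<Rightarrow> ('a, 'm) partial_object_scheme) \<Rightarrow> (nat \<Rightarrow> 'a \<Rightarrow> 'a) \<Rightarrow> bool" where
  "inductive_system obj mor A \<alpha> \<longleftrightarrow> (\<forall>k. obj (A k) \<and> mor (A k) (A (Suc k)) (\<alpha> k))"

definition cocone ::
  "(('a, 'm) partial_object_scheme \<Rightarrow> bool) \<Rightarrow>
   (('a, 'm) partial_object_scheme \<Rightarrow> ('a, 'm) partial_object_scheme \<Rightarrow> ('a \<Rightarrow> 'a) \<Rightarrow> bool) \<Rightarrow>
   (nat \<Rightarrow> ('a, 'm) partial_object_scheme) \<Rightarrow> (nat \<Rightarrow> 'a \<Rightarrow> 'a) \<Rightarrow>
   ('a, 'm) partial_object_scheme \<Rightarrow> (nat \<Rightarrow> 'a \<Rightarrow> 'a) \<Rightarrow> bool" where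
  "cocone obj mor A \<alpha> L \<iota> \<longleftrightarrow>
     obj L \<and> (\<forall>k. mor (A k) L (\<iota> k)) \<and>
     (\<forall>k. \<forall>x\<in>carrier (A k). \<iota> (Suc k) (\<alpha> k x) = \<iota> k x)"

definition mediates ::
  "(('a, 'm) partial_object_scheme \<Rightarrow> ('a, 'm) partial_object_scheme \<Rightarrow> ('a \<Rightarrow> 'a) \<Rightarrow> bool) \<Rightarrow>
   (nat \<Rightarrow> ('a, 'm) partial_object_scheme) \<Rightarrow>
   ('a, 'm) partial_object_scheme \<Rightarrow> (nat \<Rightarrow> 'a \<Rightarrow> 'a) \<Rightarrow>
   ('a, 'm) partial_object_scheme \<Rightarrow> (nat \<Rightarrow> 'a \<Rightarrow> 'a) \<Rightarrow> ('a \<Rightarrow> 'a) \<Rightarrow> bool" where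
  "mediates mor A L \<iota> W \<psi> u \<longleftrightarrow>
     mor L W u \<and> (\<forall>k. \<forall>x\<in>carrier (A k). u (\<iota> k x) = \<psi> k x)"

definition inductive_limit ::
  "(('a, 'm) partial_object_scheme \<Rightarrow> bool) \<Rightarrow>
   (('a, 'm) partial_object_scheme \<Rightarrow> ('a, 'm) partial_object_scheme \<Rightarrow> ('a \<Rightarrow> 'a) \<Rightarrow> bool) \<Rightarrow>
   (nat \<Rightarrow> ('a, 'm) partial_object_scheme) \<Rightarrow> (nat \<Rightarrow> 'a \<Rightarrow> 'a) \<Rightarrow>
   ('a, 'm) partial_object_scheme \<Rightarrow> (nat \<Rightarrow> 'a \<Rightarrow> 'a) \<Rightarrow> bool" where
  "inductive_limit obj mor A \<alpha> L \<iota> \<longleftrightarrow>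
     cocone obj mor A \<alpha> L \<iota> \<and>
     (\<forall>W \<psi>. cocone obj mor A \<alpha> W \<psi> \<longrightarrow>
        (\<exists>u. mediates mor A L \<iota> W \<psi> u \<and>
             (\<forall>u'. mediates mor A L \<iota> W \<psi> u' \<longrightarrow> (\<forall>x\<in>carrier L. u' x = u x))))"

end

theory Submission
  imports Defs
begin

text \<open>
  Since the \<open>\<phi> k\<close> are order embeddings, the limit in AOU is just the increasing union of the \<open>V k\<close>:
  the union of the cones is again proper and Archimedean. Hence a matrix over the limit \<open>L\<close> comes
  from a matrix over some \<open>V k\<close>, and by order embedding it lies in the minimal cone over \<open>L\<close> exactly
  when it does so over \<open>V k\<close>. So the mediating positive map from \<open>L\<close> to the first level of \<open>S\<close>,
  which agrees with the completely positive \<open>\<sigma> k\<close> on \<open>V k\<close>, is completely positive on OMIN of \<open>L\<close>,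
  and it is inverse to the mediating map from \<open>S\<close>.
\<close>

section \<open>Linear algebra in \<open>*\<close>-vector spaces\<close>

text \<open>Both limits are given only by their universal properties, so the elements and the cone
  of \<open>L\<close> are not visible. A concrete union \<open>glued\<close> is therefore built with
  carrier in \<open>'a\<close>, the universe over which the universal property of \<open>L\<close>
  speaks, and \<open>L\<close> is compared with it. \<open>S\<close> gets no model: its first matrix
  level, \<open>level_one S\<close>, is an AOU space, and this gives the map out of
  \<open>L\<close>. Conversely, a map out of \<open>S\<close> into \<open>OMIN L\<close> is
  available only once \<open>OMIN L\<close> is known to be an operator system. There every axiom is
  read off the quadratic forms \<open>sesq V n M c c\<close>; the hard one is the matrix order unit,
  where a single constant must serve for all vectors \<open>c\<close>, whence the bounds by the
  squared norm of \<open>c\<close>. The two composites are the identity for different reasons: on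
  \<open>S\<close> by uniqueness of mediating maps, on \<open>L\<close> because every element comes
  from some \<open>V k\<close>.\<close>

context star_space
begin

lemma smult_carrier [simp, intro]: "x \<in> carrier V \<Longrightarrow> c \<odot>\<^bsub>V\<^esub> x \<in> carrier V"
  using smult_closed[of c x] by (simp add: class_ring_simps)

lemma smult_add_left: "x \<in> carrier V \<Longrightarrow> (a + b) \<odot>\<^bsub>V\<^esub> x = a \<odot>\<^bsub>V\<^esub> x \<oplus> b \<odot>\<^bsub>V\<^esub> x"
  using smult_l_distr[of a b x] by (simp add: class_ring_simps)

lemma smult_add_right:
  "\<lbrakk>x \<in> carrier V; y \<in> carrier V\<rbrakk> \<Longrightarrow> a \<odot>\<^bsub>V\<^esub> (x \<oplus> y) = a \<odot>\<^bsub>V\<^esub> x \<oplus> a \<odot>\<^bsub>V\<^esub> y"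
  using smult_r_distr[of a x y] by (simp add: class_ring_simps)

lemma smult_smult [simp]: "x \<in> carrier V \<Longrightarrow> a \<odot>\<^bsub>V\<^esub> (b \<odot>\<^bsub>V\<^esub> x) = (a * b) \<odot>\<^bsub>V\<^esub> x"
  using smult_assoc1[of a b x] by (simp add: class_ring_simps)

lemma one_smult [simp]: "x \<in> carrier V \<Longrightarrow> 1 \<odot>\<^bsub>V\<^esub> x = x"
  using smult_one[of x] by (simp add: class_ring_simps)

lemma zero_smult [simp]: "x \<in> carrier V \<Longrightarrow> 0 \<odot>\<^bsub>V\<^esub> x = \<zero>"
  using smult_l_null[of x] by (simp add: class_ring_simps)

lemma smult_zero [simp]: "c \<odot>\<^bsub>V\<^esub> \<zero> = \<zero>"
  using smult_r_null[of c] by (simp add: class_ring_simps)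

lemma neg_conv: "x \<in> carrier V \<Longrightarrow> \<ominus> x = (-1) \<odot>\<^bsub>V\<^esub> x"
  using smult_l_minus[of 1 x] by (simp add: class_ring_simps)

lemma minus_conv: "\<lbrakk>x \<in> carrier V; y \<in> carrier V\<rbrakk> \<Longrightarrow> x \<ominus> y = x \<oplus> (-1) \<odot>\<^bsub>V\<^esub> y"
  by (simp add: a_minus_def neg_conv)

lemma smult_left_imp_zero:
  assumes "c \<odot>\<^bsub>V\<^esub> x = \<zero>" "c \<noteq> 0" "x \<in> carrier V"
  shows "x = \<zero>"
proof -
  have "inverse c \<odot>\<^bsub>V\<^esub> (c \<odot>\<^bsub>V\<^esub> x) = x" using assms(2,3) by simp
  then show ?thesis using assms(1) by simp
qed

lemma star_zero [simp]: "star V \<zero> = \<zero>"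
  using star_smult[of \<zero> 0] star_closed[of \<zero>] by simp

lemma smult_finsum:
  "\<lbrakk>finite A; f \<in> A \<rightarrow> carrier V\<rbrakk> \<Longrightarrow> c \<odot>\<^bsub>V\<^esub> finsum V f A = finsum V (\<lambda>i. c \<odot>\<^bsub>V\<^esub> f i) A"
  using finsum_smult_ldistr[of A c f] by (simp add: class_ring_simps)

lemma finsum_smult_const:
  "\<lbrakk>finite A; x \<in> carrier V\<rbrakk> \<Longrightarrow> finsum V (\<lambda>i. g i \<odot>\<^bsub>V\<^esub> x) A = sum g A \<odot>\<^bsub>V\<^esub> x"
  by (induction A rule: finite_induct) (auto simp: smult_add_left)

lemma star_finsum:
  "\<lbrakk>finite A; f \<in> A \<rightarrow> carrier V\<rbrakk> \<Longrightarrow> star V (finsum V f A) = finsum V (\<lambda>i. star V (f i)) A"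
  by (induction A rule: finite_induct) (auto simp: star_add star_closed Pi_def)

lemma hermitianD: "x \<in> hermitian V \<Longrightarrow> x \<in> carrier V" "x \<in> hermitian V \<Longrightarrow> star V x = x"
  by (auto simp: hermitian_def)

lemma hermitian_add: "\<lbrakk>x \<in> hermitian V; y \<in> hermitian V\<rbrakk> \<Longrightarrow> x \<oplus> y \<in> hermitian V"
  by (simp add: hermitian_def star_add)

lemma hermitian_smult: "x \<in> hermitian V \<Longrightarrow> complex_of_real r \<odot>\<^bsub>V\<^esub> x \<in> hermitian V"
  by (simp add: hermitian_def star_smult)

lemma hermitian_re: "x \<in> carrier V \<Longrightarrow> x \<oplus> star V x \<in> hermitian V"
  by (simp add: hermitian_def star_add star_closed star_star a_comm)

lemma hermitian_im: "x \<in> carrier V \<Longrightarrow> \<i> \<odot>\<^bsub>V\<^esub> x \<oplus> (-\<i>) \<odot>\<^bsub>V\<^esub> star V x \<in> hermitian V"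
  by (simp add: hermitian_def star_add star_closed star_star star_smult a_comm)

text \<open>Both brackets on the right are hermitian and their coefficients are real, so order
  bounds for hermitian elements become applicable to complex multiples of an arbitrary
  element.\<close>

lemma smult_plus_star:
  assumes x: "x \<in> carrier V"
  shows "z \<odot>\<^bsub>V\<^esub> x \<oplus> cnj z \<odot>\<^bsub>V\<^esub> star V x =
    complex_of_real (Re z) \<odot>\<^bsub>V\<^esub> (x \<oplus> star V x) \<oplus>
    complex_of_real (Im z) \<odot>\<^bsub>V\<^esub> (\<i> \<odot>\<^bsub>V\<^esub> x \<oplus> (-\<i>) \<odot>\<^bsub>V\<^esub> star V x)"
proof -
  define y where "y = star V x"
  have y: "y \<in> carrier V" unfolding y_def using x by (rule star_closed)
  have z: "z = complex_of_real (Re z) + complex_of_real (Im z) * \<i>"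
    "cnj z = complex_of_real (Re z) + complex_of_real (Im z) * (-\<i>)"
    by (simp_all add: complex_eq_iff)
  have "z \<odot>\<^bsub>V\<^esub> x \<oplus> cnj z \<odot>\<^bsub>V\<^esub> y =
    (complex_of_real (Re z) \<odot>\<^bsub>V\<^esub> x \<oplus> (complex_of_real (Im z) * \<i>) \<odot>\<^bsub>V\<^esub> x) \<oplus>
    (complex_of_real (Re z) \<odot>\<^bsub>V\<^esub> y \<oplus> (complex_of_real (Im z) * (-\<i>)) \<odot>\<^bsub>V\<^esub> y)"
    by (metis z smult_add_left x y)
  also have "\<dots> = complex_of_real (Re z) \<odot>\<^bsub>V\<^esub> (x \<oplus> y) \<oplus>
    complex_of_real (Im z) \<odot>\<^bsub>V\<^esub> (\<i> \<odot>\<^bsub>V\<^esub> x \<oplus> (-\<i>) \<odot>\<^bsub>V\<^esub> y)"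
    using x y by (simp add: smult_add_right a_ac)
  finally show ?thesis unfolding y_def .
qed

lemma cartesian_decomposition:
  assumes x: "x \<in> carrier V"
  obtains a b where "a \<in> hermitian V" "b \<in> hermitian V" "x = a \<oplus> \<i> \<odot>\<^bsub>V\<^esub> b"
proof
  let ?a = "complex_of_real (1/2) \<odot>\<^bsub>V\<^esub> (x \<oplus> star V x)"
  \<comment> \<open>This is \<open>(x - star V x) / (2i)\<close>, rewritten as a real multiple of
    the hermitian element from \<open>hermitian_im\<close>.\<close>
  let ?b = "complex_of_real (-1/2) \<odot>\<^bsub>V\<^esub> (\<i> \<odot>\<^bsub>V\<^esub> x \<oplus> (-\<i>) \<odot>\<^bsub>V\<^esub> star V x)"
  show "?a \<in> hermitian V" "?b \<in> hermitian V"
    using x by (intro hermitian_smult hermitian_re hermitian_im; assumption)+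
  define y where "y = star V x"
  have y: "y \<in> carrier V" unfolding y_def using x by (rule star_closed)
  have "?a \<oplus> \<i> \<odot>\<^bsub>V\<^esub> ?b = ((1/2) \<odot>\<^bsub>V\<^esub> x \<oplus> (1/2) \<odot>\<^bsub>V\<^esub> y) \<oplus> ((1/2) \<odot>\<^bsub>V\<^esub> x \<oplus> (-1/2) \<odot>\<^bsub>V\<^esub> y)"
    unfolding y_def[symmetric] using x y by (simp add: smult_add_right)
  also have "\<dots> = ((1/2) \<odot>\<^bsub>V\<^esub> x \<oplus> (1/2) \<odot>\<^bsub>V\<^esub> x) \<oplus> ((1/2) \<odot>\<^bsub>V\<^esub> y \<oplus> (-1/2) \<odot>\<^bsub>V\<^esub> y)"
    using x y by (simp add: a_ac)
  also have "\<dots> = x" using x y by (simp flip: smult_add_left)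
  finally show "x = ?a \<oplus> \<i> \<odot>\<^bsub>V\<^esub> ?b" ..
qed

end

text \<open>Closure under negatives is implied by \<open>0 \<odot> x = \<zero>\<close>.\<close>

lemma star_spaceI:
  fixes V :: "('a, 'm) star_space_scheme" (structure)
  assumes zero: "\<zero> \<in> carrier V"
    and add: "\<And>x y. \<lbrakk>x \<in> carrier V; y \<in> carrier V\<rbrakk> \<Longrightarrow> x \<oplus> y \<in> carrier V"
    and smult: "\<And>c x. x \<in> carrier V \<Longrightarrow> c \<odot>\<^bsub>V\<^esub> x \<in> carrier V"
    and comm: "\<And>x y. \<lbrakk>x \<in> carrier V; y \<in> carrier V\<rbrakk> \<Longrightarrow> x \<oplus> y = y \<oplus> x"
    and assoc: "\<And>x y z. \<lbrakk>x \<in> carrier V; y \<in> carrier V; z \<in> carrier V\<rbrakk> \<Longrightarrow> x \<oplus> y \<oplus> z = x \<oplus> (y \<oplus> z)"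
    and one: "\<And>x. x \<in> carrier V \<Longrightarrow> 1 \<odot>\<^bsub>V\<^esub> x = x"
    and null: "\<And>x. x \<in> carrier V \<Longrightarrow> 0 \<odot>\<^bsub>V\<^esub> x = \<zero>"
    and mult: "\<And>a b x. x \<in> carrier V \<Longrightarrow> (a * b) \<odot>\<^bsub>V\<^esub> x = a \<odot>\<^bsub>V\<^esub> (b \<odot>\<^bsub>V\<^esub> x)"
    and left: "\<And>a b x. x \<in> carrier V \<Longrightarrow> (a + b) \<odot>\<^bsub>V\<^esub> x = a \<odot>\<^bsub>V\<^esub> x \<oplus> b \<odot>\<^bsub>V\<^esub> x"
    and right: "\<And>a x y. \<lbrakk>x \<in> carrier V; y \<in> carrier V\<rbrakk> \<Longrightarrow> a \<odot>\<^bsub>V\<^esub> (x \<oplus> y) = a \<odot>\<^bsub>V\<^esub> x \<oplus> a \<odot>\<^bsub>V\<^esub> y"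
    and star: "star_space_axioms V"
  shows "star_space V"
proof -
  have add_zero: "x \<oplus> \<zero> = x" if "x \<in> carrier V" for x
    using left[OF that, of 1 0] by (simp add: one null that)
  have neg: "\<exists>y\<in>carrier V. x \<oplus> y = \<zero>" if "x \<in> carrier V" for x
    using left[OF that, of 1 "-1"] that by (auto simp: one null intro!: bexI[of _ "(-1) \<odot>\<^bsub>V\<^esub> x"] smult)
  have "module (class_ring :: complex ring) V"
    by (rule LinearCombinations.module_criteria)
      (auto simp: class_ring_simps class_cring.is_cring zero add smult one mult left right neg add_zero
        intro: comm assoc)
  then show ?thesis
    using star class_field by (simp add: star_space_def vectorspace_def)
qed

text \<open>Additive inverses are replaced by multiples with \<open>-1\<close>, so a structure built
  by hand needs no formula for negation. Of the Archimedean equality only the inclusion that does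
  not follow from the cone axioms is left to check.\<close>

lemma aou_spaceI:
  fixes V :: "'a aou_space" (structure)
  assumes "star_space V"
    and herm: "pcone V \<subseteq> hermitian V"
    and add: "\<And>x y. \<lbrakk>x \<in> pcone V; y \<in> pcone V\<rbrakk> \<Longrightarrow> x \<oplus> y \<in> pcone V"
    and smult: "\<And>r x. \<lbrakk>(0::real) \<le> r; x \<in> pcone V\<rbrakk> \<Longrightarrow> complex_of_real r \<odot>\<^bsub>V\<^esub> x \<in> pcone V"
    and proper: "\<And>x. \<lbrakk>x \<in> pcone V; (-1) \<odot>\<^bsub>V\<^esub> x \<in> pcone V\<rbrakk> \<Longrightarrow> x = \<zero>"
    and unit: "ounit V \<in> pcone V"
    and order_unit: "\<And>x. x \<in> hermitian V \<Longrightarrow>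
      \<exists>r>0. complex_of_real r \<odot>\<^bsub>V\<^esub> ounit V \<oplus> (-1) \<odot>\<^bsub>V\<^esub> x \<in> pcone V"
    and archimedean: "\<And>x. \<lbrakk>x \<in> hermitian V; \<And>r. r > 0 \<Longrightarrow> complex_of_real r \<odot>\<^bsub>V\<^esub> ounit V \<oplus> x \<in> pcone V\<rbrakk>
      \<Longrightarrow> x \<in> pcone V"
  shows "aou_space V"
proof -
  interpret star_space V by fact
  have carrier: "x \<in> carrier V" if "x \<in> pcone V" for x
    using that herm by (auto simp: hermitian_def)
  have zero: "\<zero> \<in> pcone V" using smult[OF order_refl unit] carrier[OF unit] by simp
  show ?thesis
  proof (unfold_locales, goal_cases)
    case 4
    have "x = \<zero>" if "x \<in> pcone V" "x = \<ominus> y" "y \<in> pcone V" for x y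
    proof -
      have "(-1) \<odot>\<^bsub>V\<^esub> x = y" using that carrier[of y] by (simp add: neg_conv)
      then show ?thesis using that proper by auto
    qed
    moreover have "\<zero> = \<ominus> \<zero>" by (simp add: neg_conv)
    ultimately show ?case using zero by blast
  next
    case (6 x)
    then show ?case
      using order_unit[OF 6] carrier[OF unit] by (simp add: minus_conv hermitian_def)
  next
    case 7
    have "complex_of_real r \<odot>\<^bsub>V\<^esub> ounit V \<oplus> x \<in> pcone V" if "x \<in> pcone V" "r > 0" for x r
      using that by (intro add smult unit) auto
    then show ?case using herm archimedean by blast
  qed (use herm add smult unit in auto)
qed

context aou_space
begin

lemma pcone_carrier: "x \<in> pcone V \<Longrightarrow> x \<in> carrier V"
  using pcone_hermitian by (auto simp: hermitian_def)

lemma ounit_carrier [simp, intro]: "ounit V \<in> carrier V"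
  using ounit_pcone by (rule pcone_carrier)

lemma ounit_hermitian: "ounit V \<in> hermitian V"
  using ounit_pcone pcone_hermitian by blast

lemma pcone_antisym: "\<lbrakk>x \<in> pcone V; (-1) \<odot>\<^bsub>V\<^esub> x \<in> pcone V\<rbrakk> \<Longrightarrow> x = \<zero>"
proof -
  assume x: "x \<in> pcone V" "(-1) \<odot>\<^bsub>V\<^esub> x \<in> pcone V"
  have "x = \<ominus> ((-1) \<odot>\<^bsub>V\<^esub> x)" using pcone_carrier[OF x(1)] by (simp add: neg_conv)
  then have "x \<in> pcone V \<inter> (\<lambda>x. \<ominus> x) ` pcone V" using x by blast
  then show "x = \<zero>" using pcone_proper by blast
qed

lemma order_unit_add:
  "x \<in> hermitian V \<Longrightarrow> \<exists>r>0. complex_of_real r \<odot>\<^bsub>V\<^esub> ounit V \<oplus> (-1) \<odot>\<^bsub>V\<^esub> x \<in> pcone V"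
  using order_unit[of x] by (simp add: minus_conv hermitian_def)

lemma archimedeanI:
  "\<lbrakk>x \<in> hermitian V; \<And>r. r > 0 \<Longrightarrow> complex_of_real r \<odot>\<^bsub>V\<^esub> ounit V \<oplus> x \<in> pcone V\<rbrakk> \<Longrightarrow> x \<in> pcone V"
  using archimedean by blast

end

section \<open>Sesquilinear forms of matrices\<close>

lemma mat_over_iff:
  "M \<in> mat_over V n \<longleftrightarrow> M \<in> carrier_mat n n \<and> (\<forall>i<n. \<forall>j<n. M $$ (i, j) \<in> carrier V)"
  by (fastforce simp: mat_over_def)

lemma mat_over_entry: "\<lbrakk>M \<in> mat_over V n; i < n; j < n\<rbrakk> \<Longrightarrow> M $$ (i, j) \<in> carrier V"
  by (simp add: mat_over_iff)

lemma mat_over_dim: "M \<in> mat_over V n \<Longrightarrow> dim_row M = n" "M \<in> mat_over V n \<Longrightarrow> dim_col M = n"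
  by (auto simp: mat_over_iff)

lemma mat_in_mat_over [intro]:
  "(\<And>i j. \<lbrakk>i < n; j < n\<rbrakk> \<Longrightarrow> f (i, j) \<in> carrier V) \<Longrightarrow> mat n n f \<in> mat_over V n"
  by (simp add: mat_over_iff)

lemma map_mat_mat_over:
  "\<lbrakk>M \<in> mat_over V n; f \<in> carrier V \<rightarrow> carrier W\<rbrakk> \<Longrightarrow> map_mat f M \<in> mat_over W n"
  by (auto simp: mat_over_iff)

lemma map_mat_cong_mat_over:
  "\<lbrakk>M \<in> mat_over V n; \<And>x. x \<in> carrier V \<Longrightarrow> f x = g x\<rbrakk> \<Longrightarrow> map_mat f M = map_mat g M"
  by (rule eq_matI) (auto simp: mat_over_iff)

lemma map_mat_map_mat: "map_mat g (map_mat f M) = map_mat (\<lambda>x. g (f x)) M"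
  by (rule eq_matI) auto

text \<open>Conjugate-linear in \<open>c\<close>, linear in \<open>d\<close>. The minimal cone tests
  only \<open>c = d\<close>; the second argument is there for polarization.\<close>

definition sesq ::
  "('a, 'm) star_space_scheme \<Rightarrow> nat \<Rightarrow> 'a mat \<Rightarrow> (nat \<Rightarrow> complex) \<Rightarrow> (nat \<Rightarrow> complex) \<Rightarrow> 'a" where
  "sesq V n M c d =
     finsum V (\<lambda>(i, j). (cnj (c i) * d j) \<odot>\<^bsub>V\<^esub> M $$ (i, j)) ({..<n} \<times> {..<n})"

context star_space
begin

lemma finsum_add_distrib:
  assumes "f \<in> A \<rightarrow> carrier V" "g \<in> A \<rightarrow> carrier V" "\<And>x. x \<in> A \<Longrightarrow> h x = f x \<oplus> g x"
  shows "finsum V h A = finsum V f A \<oplus> finsum V g A"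
proof -
  have "finsum V h A = finsum V (\<lambda>x. f x \<oplus> g x) A"
    using assms by (intro finsum_cong') (auto simp: Pi_def)
  then show ?thesis using assms by (simp add: finsum_addf)
qed

lemma finsum_smult_distrib:
  assumes "finite A" "f \<in> A \<rightarrow> carrier V" "\<And>x. x \<in> A \<Longrightarrow> h x = c \<odot>\<^bsub>V\<^esub> f x"
  shows "finsum V h A = c \<odot>\<^bsub>V\<^esub> finsum V f A"
proof -
  have "finsum V h A = finsum V (\<lambda>x. c \<odot>\<^bsub>V\<^esub> f x) A"
    using assms by (intro finsum_cong') (auto simp: Pi_def)
  then show ?thesis using assms by (simp add: smult_finsum)
qed

lemma sesq_closed [simp, intro]: "M \<in> mat_over V n \<Longrightarrow> sesq V n M c d \<in> carrier V"
  unfolding sesq_def by (intro finsum_closed) (auto simp: mat_over_entry)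

lemma sesq_add_left:
  "M \<in> mat_over V n \<Longrightarrow> sesq V n M (\<lambda>i. c i + c' i) d = sesq V n M c d \<oplus> sesq V n M c' d"
  unfolding sesq_def
  by (rule finsum_add_distrib) (auto simp: mat_over_entry algebra_simps simp flip: smult_add_left)

lemma sesq_add_right:
  "M \<in> mat_over V n \<Longrightarrow> sesq V n M c (\<lambda>i. d i + d' i) = sesq V n M c d \<oplus> sesq V n M c d'"
  unfolding sesq_def
  by (rule finsum_add_distrib) (auto simp: mat_over_entry algebra_simps simp flip: smult_add_left)

lemma sesq_smult_left:
  "M \<in> mat_over V n \<Longrightarrow> sesq V n M (\<lambda>i. a * c i) d = cnj a \<odot>\<^bsub>V\<^esub> sesq V n M c d"
  unfolding sesq_def
  by (rule finsum_smult_distrib) (auto simp: mat_over_entry algebra_simps)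

lemma sesq_smult_right:
  "M \<in> mat_over V n \<Longrightarrow> sesq V n M c (\<lambda>i. a * d i) = a \<odot>\<^bsub>V\<^esub> sesq V n M c d"
  unfolding sesq_def
  by (rule finsum_smult_distrib) (auto simp: mat_over_entry algebra_simps)

lemma sesq_indicator:
  assumes M: "M \<in> mat_over V n" and ij: "i < n" "j < n"
  shows "sesq V n M (\<lambda>k. if k = i then 1 else 0) (\<lambda>k. if k = j then 1 else 0) = M $$ (i, j)"
proof -
  have "sesq V n M (\<lambda>k. if k = i then 1 else 0) (\<lambda>k. if k = j then 1 else 0) =
      finsum V (\<lambda>k. if (i, j) = k then M $$ k else \<zero>) ({..<n} \<times> {..<n})"
    unfolding sesq_def using M ij
    by (intro finsum_cong') (auto simp: mat_over_entry split: if_splits)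
  also have "\<dots> = M $$ (i, j)"
    using M ij by (intro finsum_singleton) (auto simp: mat_over_entry)
  finally show ?thesis .
qed

text \<open>Write \<open>B\<close> for the form. Expanding at \<open>c + d\<close> gives
  \<open>B(c,d) + B(d,c) = 0\<close>; the same with \<open>\<i> d\<close> in place of
  \<open>d\<close> gives \<open>B(c,d) - B(d,c) = 0\<close> up to a factor. Complex scalars are
  essential here.\<close>

lemma sesq_polarization:
  assumes M: "M \<in> mat_over V n" and zero: "\<And>c. sesq V n M c c = \<zero>"
  shows "sesq V n M c d = \<zero>"
proof -
  have sum: "sesq V n M c d \<oplus> sesq V n M d c = \<zero>" for c d
  proof -
    have "sesq V n M (\<lambda>i. c i + d i) (\<lambda>i. c i + d i) =
        (sesq V n M c c \<oplus> sesq V n M c d) \<oplus> (sesq V n M d c \<oplus> sesq V n M d d)"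
      using M by (simp only: sesq_add_left sesq_add_right)
    then show ?thesis using M by (simp add: zero)
  qed
  define x where "x = sesq V n M c d"
  define y where "y = sesq V n M d c"
  have xy: "x \<in> carrier V" "y \<in> carrier V" unfolding x_def y_def using M by auto
  have 1: "x \<oplus> y = \<zero>" unfolding x_def y_def by (rule sum)
  have "\<i> \<odot>\<^bsub>V\<^esub> x \<oplus> (-\<i>) \<odot>\<^bsub>V\<^esub> y = \<zero>"
    unfolding x_def y_def using sum[of c "\<lambda>i. \<i> * d i"] M
    by (simp add: sesq_smult_left sesq_smult_right)
  then have "(-\<i>) \<odot>\<^bsub>V\<^esub> (\<i> \<odot>\<^bsub>V\<^esub> x \<oplus> (-\<i>) \<odot>\<^bsub>V\<^esub> y) = \<zero>" by simp
  then have 2: "x \<oplus> (-1) \<odot>\<^bsub>V\<^esub> y = \<zero>" using xy by (simp add: smult_add_right)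
  have "2 \<odot>\<^bsub>V\<^esub> x = x \<oplus> x" using smult_add_left[of x 1 1] xy by simp
  also have "\<dots> = (x \<oplus> x) \<oplus> (y \<oplus> (-1) \<odot>\<^bsub>V\<^esub> y)"
    using smult_add_left[of y 1 "-1"] xy by simp
  also have "\<dots> = (x \<oplus> y) \<oplus> (x \<oplus> (-1) \<odot>\<^bsub>V\<^esub> y)"
    using xy by (simp add: a_ac)
  finally have "2 \<odot>\<^bsub>V\<^esub> x = \<zero>" using 1 2 by simp
  then show ?thesis unfolding x_def[symmetric] by (rule smult_left_imp_zero) (use xy in auto)
qed

lemma sesq_mat_add:
  "\<lbrakk>M \<in> mat_over V n; N \<in> mat_over V n\<rbrakk> \<Longrightarrow>
    sesq V n (mat n n (\<lambda>ij. M $$ ij \<oplus> N $$ ij)) c d = sesq V n M c d \<oplus> sesq V n N c d"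
  unfolding sesq_def by (rule finsum_add_distrib) (auto simp: mat_over_entry smult_add_right)

lemma sesq_mat_smult:
  "M \<in> mat_over V n \<Longrightarrow>
    sesq V n (mat n n (\<lambda>ij. a \<odot>\<^bsub>V\<^esub> M $$ ij)) c d = a \<odot>\<^bsub>V\<^esub> sesq V n M c d"
  unfolding sesq_def by (rule finsum_smult_distrib) (auto simp: mat_over_entry mult.commute)

lemma sesq_mat_zero: "sesq V n (mat n n (\<lambda>_. \<zero>)) c d = \<zero>"
proof -
  have "sesq V n (mat n n (\<lambda>_. \<zero>)) c d = finsum V (\<lambda>_. \<zero>) ({..<n} \<times> {..<n})"
    unfolding sesq_def by (intro finsum_cong') auto
  then show ?thesis by simp
qed

lemma sesq_mat_star:
  assumes M: "M \<in> mat_over V n"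
  shows "sesq V n (mat n n (\<lambda>(i, j). star V (M $$ (j, i)))) c d = star V (sesq V n M d c)"
proof -
  have "star V (sesq V n M d c) =
      finsum V (\<lambda>(i, j). (cnj (c j) * d i) \<odot>\<^bsub>V\<^esub> star V (M $$ (i, j))) ({..<n} \<times> {..<n})"
    unfolding sesq_def using M
    by (subst star_finsum)
      (auto simp: mat_over_entry star_smult star_closed mult.commute intro!: finsum_cong')
  also have "\<dots> = finsum V (\<lambda>(i, j). (cnj (c i) * d j) \<odot>\<^bsub>V\<^esub> star V (M $$ (j, i))) ({..<n} \<times> {..<n})"
    using M by (intro add.finprod_swap) (auto simp: mat_over_entry star_closed)
  also have "\<dots> = sesq V n (mat n n (\<lambda>(i, j). star V (M $$ (j, i)))) c d"
    unfolding sesq_def using M by (intro finsum_cong') (auto simp: mat_over_entry star_closed)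
  finally show ?thesis ..
qed

text \<open>Polarization makes all values of the form of the difference vanish, and unit vectors
  read off its entries. This is how facts known only for values of forms, such as hermitian symmetry
  and properness of the minimal cone, pass back to matrices.\<close>

lemma mat_eqI_sesq:
  assumes M: "M \<in> mat_over V n" and N: "N \<in> mat_over V n"
    and eq: "\<And>c. sesq V n M c c = sesq V n N c c"
  shows "M = N"
proof (rule eq_matI)
  fix i j assume "i < dim_row N" "j < dim_col N"
  then have ij: "i < n" "j < n" using N by (auto simp: mat_over_dim)
  let ?N' = "mat n n (\<lambda>ij. (-1) \<odot>\<^bsub>V\<^esub> N $$ ij)"
  let ?D = "mat n n (\<lambda>ij. M $$ ij \<oplus> ?N' $$ ij)"
  have N': "?N' \<in> mat_over V n" using N by (auto simp: mat_over_entry)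
  have D: "?D \<in> mat_over V n" using M N by (auto simp: mat_over_entry)
  have "sesq V n ?D c c = \<zero>" for c
    using smult_add_left[of "sesq V n N c c" 1 "-1"] M N
    by (simp add: sesq_mat_add[OF M N'] sesq_mat_smult eq)
  then have "?D $$ (i, j) = \<zero>"
    using sesq_polarization[OF D] sesq_indicator[OF D ij] by metis
  then have zero: "M $$ (i, j) \<oplus> (-1) \<odot>\<^bsub>V\<^esub> N $$ (i, j) = \<zero>" using ij by simp
  have carr: "M $$ (i, j) \<in> carrier V" "N $$ (i, j) \<in> carrier V"
    using M N ij by (auto simp: mat_over_entry)
  have "M $$ (i, j) = M $$ (i, j) \<oplus> ((-1) \<odot>\<^bsub>V\<^esub> N $$ (i, j) \<oplus> N $$ (i, j))"
    using smult_add_left[of "N $$ (i, j)" "-1" 1] carr by simp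
  also have "\<dots> = N $$ (i, j)" using zero carr by (simp flip: a_assoc)
  finally show "M $$ (i, j) = N $$ (i, j)" .
qed (use M N in \<open>auto simp: mat_over_dim\<close>)

text \<open>Only the diagonal terms survive. Consequently \<open>r\<close> times the matrix unit
  dominates \<open>M\<close> in the minimal order exactly when the form of \<open>M\<close> is
  bounded by \<open>r\<close> times the squared norm of \<open>c\<close>, which fixes the shape of
  the estimates below.\<close>

lemma sesq_mat_unit:
  assumes e: "e \<in> carrier V"
  shows "sesq V n (mat n n (\<lambda>(i, j). if i = j then e else \<zero>)) c c =
    complex_of_real (\<Sum>i<n. (cmod (c i))\<^sup>2) \<odot>\<^bsub>V\<^esub> e"
proof -
  have "sesq V n (mat n n (\<lambda>(i, j). if i = j then e else \<zero>)) c c =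
      finsum V (\<lambda>(i, j). (if i = j then cnj (c i) * c j else 0) \<odot>\<^bsub>V\<^esub> e) ({..<n} \<times> {..<n})"
    unfolding sesq_def using e by (intro finsum_cong') auto
  also have "\<dots> = (\<Sum>(i, j)\<in>{..<n} \<times> {..<n}. if i = j then cnj (c i) * c j else 0) \<odot>\<^bsub>V\<^esub> e"
    using e by (subst finsum_smult_const[symmetric]) (auto simp: case_prod_unfold)
  also have "(\<Sum>(i, j)\<in>{..<n} \<times> {..<n}. if i = j then cnj (c i) * c j else 0) =
      complex_of_real (\<Sum>i<n. (cmod (c i))\<^sup>2)"
    by (simp add: sum.cartesian_product[symmetric] complex_norm_square[symmetric] mult.commute[of "cnj _"]
      del: of_real_power)
  finally show ?thesis .
qed

lemma compress_mat_over:
  "M \<in> mat_over V n \<Longrightarrow> compress V n m \<alpha> M \<in> mat_over V m"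
  unfolding compress_def by (auto intro!: finsum_closed simp: mat_over_entry)

text \<open>Regrouping the double sum moves \<open>\<alpha>\<close> from the matrix to the vector.
  Compression thus only restricts the vectors at which the form of \<open>M\<close> is tested, so it
  preserves the minimal cone.\<close>

lemma sesq_compress:
  assumes M: "M \<in> mat_over V n"
  shows "sesq V m (compress V n m \<alpha> M) c c =
    sesq V n M (\<lambda>i. \<Sum>p<m. \<alpha> $$ (i, p) * c p) (\<lambda>i. \<Sum>p<m. \<alpha> $$ (i, p) * c p)"
proof -
  let ?n = "{..<n} \<times> {..<n}" and ?m = "{..<m} \<times> {..<m}"
  let ?g = "\<lambda>pq ij. cnj (c (fst pq)) * c (snd pq) * (cnj (\<alpha> $$ (fst ij, fst pq)) * \<alpha> $$ (snd ij, snd pq))"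
  have entry: "M $$ ij \<in> carrier V" if "ij \<in> ?n" for ij
    using M that by (auto simp: mat_over_entry)
  have "sesq V m (compress V n m \<alpha> M) c c =
      finsum V (\<lambda>pq. finsum V (\<lambda>ij. ?g pq ij \<odot>\<^bsub>V\<^esub> M $$ ij) ?n) ?m"
    unfolding sesq_def
  proof (intro finsum_cong' refl)
    fix pq assume pq: "pq \<in> ?m"
    then obtain p q where [simp]: "pq = (p, q)" and "p < m" "q < m" by auto
    then show "(case pq of (p, q) \<Rightarrow> (cnj (c p) * c q) \<odot>\<^bsub>V\<^esub> compress V n m \<alpha> M $$ (p, q)) =
        finsum V (\<lambda>ij. ?g pq ij \<odot>\<^bsub>V\<^esub> M $$ ij) ?n"
      by (auto simp: compress_def entry intro!: finsum_smult_distrib[symmetric])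
  qed (auto intro!: finsum_closed simp: entry)
  also have "\<dots> = finsum V (\<lambda>ij. finsum V (\<lambda>pq. ?g pq ij \<odot>\<^bsub>V\<^esub> M $$ ij) ?m) ?n"
    by (rule add.finprod_finprod_swap) (auto simp: entry)
  also have "\<dots> = sesq V n M (\<lambda>i. \<Sum>p<m. \<alpha> $$ (i, p) * c p) (\<lambda>i. \<Sum>p<m. \<alpha> $$ (i, p) * c p)"
    unfolding sesq_def
  proof (intro finsum_cong' refl)
    fix ij assume ij: "ij \<in> ?n"
    have "cnj (\<Sum>p<m. \<alpha> $$ (fst ij, p) * c p) * (\<Sum>q<m. \<alpha> $$ (snd ij, q) * c q) =
        (\<Sum>pq\<in>?m. ?g pq ij)"
      unfolding cnj_sum sum_product sum.cartesian_product
      by (intro sum.cong) (auto simp: mult_ac)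
    then show "finsum V (\<lambda>pq. ?g pq ij \<odot>\<^bsub>V\<^esub> M $$ ij) ?m =
        (case ij of (i, j) \<Rightarrow> (cnj (\<Sum>p<m. \<alpha> $$ (i, p) * c p) * (\<Sum>p<m. \<alpha> $$ (j, p) * c p)) \<odot>\<^bsub>V\<^esub> M $$ (i, j))"
      using entry[OF ij] by (simp only: finsum_smult_const finite_SigmaI finite_lessThan case_prod_unfold prod.collapse)
  qed (auto simp: entry)
  finally show ?thesis .
qed

end

section \<open>OMIN is an operator system\<close>

lemma matrix_level_simps [simp]:
  "carrier (matrix_level A n) = mat_over A n"
  "\<zero>\<^bsub>matrix_level A n\<^esub> = mat n n (\<lambda>_. \<zero>\<^bsub>A\<^esub>)"
  "M \<oplus>\<^bsub>matrix_level A n\<^esub> N = mat n n (\<lambda>ij. M $$ ij \<oplus>\<^bsub>A\<^esub> N $$ ij)"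
  "c \<odot>\<^bsub>matrix_level A n\<^esub> M = mat n n (\<lambda>ij. c \<odot>\<^bsub>A\<^esub> M $$ ij)"
  "star (matrix_level A n) M = mat n n (\<lambda>(i, j). star A (M $$ (j, i)))"
  "ounit (matrix_level A n) = mat n n (\<lambda>(i, j). if i = j then ounit A else \<zero>\<^bsub>A\<^esub>)"
  "pcone (matrix_level A n) = mcone A n"
  by (simp_all add: matrix_level_def)

lemma star_space_matrix_level:
  assumes "star_space A"
  shows "star_space (matrix_level A n)"
proof -
  interpret star_space A by fact
  show ?thesis
  proof (rule star_spaceI)
    show "star_space_axioms (matrix_level A n)"
      by (rule star_space_axioms.intro)
        (auto simp: mat_over_entry mat_over_dim star_closed star_star star_add star_smult intro!: eq_matI)
  next
    fix M N assume "M \<in> carrier (matrix_level A n)" "N \<in> carrier (matrix_level A n)"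
    then show "M \<oplus>\<^bsub>matrix_level A n\<^esub> N = N \<oplus>\<^bsub>matrix_level A n\<^esub> M"
      by (auto simp: mat_over_entry a_comm intro!: eq_matI)
  qed (auto simp: mat_over_entry mat_over_dim a_assoc smult_add_left smult_add_right intro!: eq_matI)
qed

lemma star_space_cong:
  fixes V :: "('a, 'm) star_space_scheme" and W :: "('a, 'n) star_space_scheme"
  assumes "star_space V" "carrier W = carrier V" "zero W = zero V" "add W = add V"
    "smult W = smult V" "star W = star V"
  shows "star_space W"
proof -
  interpret star_space V by fact
  show ?thesis
    by (rule star_spaceI; (rule star_space_axioms.intro)?)
      (auto simp: assms(2-) star_closed star_star star_add star_smult a_ac smult_add_left smult_add_right)
qed

lemma OMIN_simps [simp]:
  "carrier (OMIN V) = carrier V" "zero (OMIN V) = zero V" "add (OMIN V) = add V"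
  "smult (OMIN V) = smult V" "star (OMIN V) = star V" "ounit (OMIN V) = ounit V"
  by (simp_all add: OMIN_def)

lemma finsum_OMIN [simp]: "finsum (OMIN V) = finsum V"
  by (intro ext) (simp add: finsum_def finprod_def)

lemma mat_over_OMIN [simp]: "mat_over (OMIN V) n = mat_over V n"
  by (simp add: mat_over_def)

lemma sesq_OMIN [simp]: "sesq (OMIN V) = sesq V"
  by (intro ext) (simp add: sesq_def)

lemma compress_OMIN [simp]: "compress (OMIN V) = compress V"
  by (intro ext) (simp add: compress_def)

lemma mcone_OMIN:
  "M \<in> mcone (OMIN V) n \<longleftrightarrow> M \<in> mat_over V n \<and> (\<forall>c. sesq V n M c c \<in> pcone V)"
  by (simp add: OMIN_def sesq_def)

section \<open>Order bounds by multiples of the unit, and the matrix order unit of OMIN\<close>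

context aou_space
begin

text \<open>The order relation \<open>x \<le> r e\<close>. It is one-sided: a bound from below is a
  bound on the negative of \<open>x\<close>.\<close>

definition dominated :: "real \<Rightarrow> 'a \<Rightarrow> bool" where
  "dominated r x \<longleftrightarrow> x \<in> carrier V \<and> complex_of_real r \<odot>\<^bsub>V\<^esub> ounit V \<oplus> (-1) \<odot>\<^bsub>V\<^esub> x \<in> pcone V"

lemma dominated_add:
  assumes "dominated r x" "dominated s y"
  shows "dominated (r + s) (x \<oplus> y)"
proof -
  have "(complex_of_real r \<odot>\<^bsub>V\<^esub> ounit V \<oplus> (-1) \<odot>\<^bsub>V\<^esub> x) \<oplus> (complex_of_real s \<odot>\<^bsub>V\<^esub> ounit V \<oplus> (-1) \<odot>\<^bsub>V\<^esub> y)
      = complex_of_real (r + s) \<odot>\<^bsub>V\<^esub> ounit V \<oplus> (-1) \<odot>\<^bsub>V\<^esub> (x \<oplus> y)"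
    using assms by (simp add: dominated_def smult_add_left smult_add_right a_ac)
  then show ?thesis
    using assms pcone_add unfolding dominated_def by (metis a_closed)
qed

lemma dominated_smult:
  assumes "dominated r x" "0 \<le> t"
  shows "dominated (t * r) (complex_of_real t \<odot>\<^bsub>V\<^esub> x)"
proof -
  have "complex_of_real t \<odot>\<^bsub>V\<^esub> (complex_of_real r \<odot>\<^bsub>V\<^esub> ounit V \<oplus> (-1) \<odot>\<^bsub>V\<^esub> x)
      = complex_of_real (t * r) \<odot>\<^bsub>V\<^esub> ounit V \<oplus> (-1) \<odot>\<^bsub>V\<^esub> (complex_of_real t \<odot>\<^bsub>V\<^esub> x)"
    using assms by (simp add: dominated_def smult_add_right)
  then show ?thesis
    using assms pcone_smult[of t] unfolding dominated_def by (metis smult_carrier)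
qed

lemma dominated_zero: "0 \<le> r \<Longrightarrow> dominated r \<zero>"
  using ounit_pcone by (simp add: dominated_def pcone_smult)

lemma dominated_mono: "\<lbrakk>dominated r x; r \<le> s\<rbrakk> \<Longrightarrow> dominated s x"
  using dominated_add[of r x "s - r" \<zero>] dominated_zero[of "s - r"] by (simp add: dominated_def)

lemma dominated_finsum:
  "\<lbrakk>finite A; \<And>i. i \<in> A \<Longrightarrow> dominated (r i) (f i)\<rbrakk> \<Longrightarrow> dominated (sum r A) (finsum V f A)"
proof (induction A rule: finite_induct)
  case (insert a A)
  then have "f \<in> A \<rightarrow> carrier V" "f a \<in> carrier V" by (auto simp: dominated_def)
  with insert show ?case by (simp add: dominated_add)
qed (simp add: dominated_zero)

text \<open>One constant serves both signs of \<open>t\<close>: the bounds for \<open>h\<close> and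
  for its negative are added.\<close>

lemma hermitian_dominated:
  assumes h: "h \<in> hermitian V"
  obtains r where "0 \<le> r" "\<And>t. dominated (\<bar>t\<bar> * r) (complex_of_real t \<odot>\<^bsub>V\<^esub> h)"
proof -
  have h': "(-1) \<odot>\<^bsub>V\<^esub> h \<in> hermitian V" using hermitian_smult[OF h, of "-1"] by simp
  obtain r where r: "r > 0" "dominated r h"
    using order_unit_add[OF h] hermitianD(1)[OF h] by (auto simp: dominated_def)
  obtain s where s: "s > 0" "dominated s ((-1) \<odot>\<^bsub>V\<^esub> h)"
    using order_unit_add[OF h'] hermitianD(1)[OF h'] by (auto simp: dominated_def)
  have "dominated (\<bar>t\<bar> * (r + s)) (complex_of_real t \<odot>\<^bsub>V\<^esub> h)" for t
  proof (cases "0 \<le> t")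
    case True
    then show ?thesis
      using r s by (intro dominated_mono[OF dominated_smult[OF r(2) True]]) (auto intro: mult_left_mono)
  next
    case False
    then have "dominated (-t * s) (complex_of_real (-t) \<odot>\<^bsub>V\<^esub> ((-1) \<odot>\<^bsub>V\<^esub> h))"
      by (intro dominated_smult s) auto
    then have "dominated (-t * s) (complex_of_real t \<odot>\<^bsub>V\<^esub> h)" using hermitianD(1)[OF h] by simp
    then show ?thesis
      by (rule dominated_mono)
        (use r s False in \<open>simp add: distrib_left mult_nonpos_nonneg\<close>)
  qed
  then show ?thesis using r s by (intro that[of "r + s"]) auto
qed

text \<open>Real and imaginary part of \<open>z\<close> are treated separately, and both are at most
  \<open>cmod z\<close> in absolute value. That \<open>R\<close> does not depend on \<open>z\<close>
  is what the estimate over all vectors \<open>c\<close> rests on.\<close>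

lemma re_smult_dominated:
  assumes x: "x \<in> carrier V"
  obtains R where "0 \<le> R"
    "\<And>z. dominated (cmod z * R) (z \<odot>\<^bsub>V\<^esub> x \<oplus> cnj z \<odot>\<^bsub>V\<^esub> star V x)"
proof -
  obtain r where r: "0 \<le> r" "\<And>t. dominated (\<bar>t\<bar> * r) (complex_of_real t \<odot>\<^bsub>V\<^esub> (x \<oplus> star V x))"
    using hermitian_dominated[OF hermitian_re[OF x]] by blast
  obtain s where s: "0 \<le> s"
    "\<And>t. dominated (\<bar>t\<bar> * s) (complex_of_real t \<odot>\<^bsub>V\<^esub> (\<i> \<odot>\<^bsub>V\<^esub> x \<oplus> (-\<i>) \<odot>\<^bsub>V\<^esub> star V x))"
    using hermitian_dominated[OF hermitian_im[OF x]] by blast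
  have "dominated (cmod z * (r + s)) (z \<odot>\<^bsub>V\<^esub> x \<oplus> cnj z \<odot>\<^bsub>V\<^esub> star V x)" for z
    unfolding smult_plus_star[OF x]
  proof (rule dominated_mono[OF dominated_add[OF r(2) s(2)]])
    show "\<bar>Re z\<bar> * r + \<bar>Im z\<bar> * s \<le> cmod z * (r + s)"
      using mult_right_mono[OF abs_Re_le_cmod[of z] r(1)] mult_right_mono[OF abs_Im_le_cmod[of z] s(1)]
      by (simp add: algebra_simps)
  qed
  then show ?thesis using r s by (intro that[of "r + s"]) auto
qed

text \<open>A hermitian value \<open>w\<close> of the form satisfies
  \<open>2w = w + star V w\<close>, and the right side is a sum over the entries of terms as in
  \<open>re_smult_dominated\<close>. Each is bounded by a constant of its entry times the product of
  \<open>cmod (c i)\<close> and \<open>cmod (c j)\<close>, and this product is at most the squared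
  norm of \<open>c\<close>; so the sum of the constants serves every \<open>c\<close>.\<close>

lemma sesq_hermitian_dominated:
  assumes M: "M \<in> mat_over V n" and herm: "\<And>c. sesq V n M c c \<in> hermitian V"
  obtains r where "0 < r" "\<And>c. dominated (r * (\<Sum>i<n. (cmod (c i))\<^sup>2)) (sesq V n M c c)"
proof -
  let ?n = "{..<n} \<times> {..<n}"
  have "\<forall>ij\<in>?n. \<exists>R\<ge>0. \<forall>z. dominated (cmod z * R) (z \<odot>\<^bsub>V\<^esub> M $$ ij \<oplus> cnj z \<odot>\<^bsub>V\<^esub> star V (M $$ ij))"
    using re_smult_dominated M by (metis mem_Sigma_iff lessThan_iff mat_over_entry surj_pair)
  then obtain R where R: "\<And>ij. ij \<in> ?n \<Longrightarrow> 0 \<le> R ij"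
    "\<And>ij z. ij \<in> ?n \<Longrightarrow> dominated (cmod z * R ij) (z \<odot>\<^bsub>V\<^esub> M $$ ij \<oplus> cnj z \<odot>\<^bsub>V\<^esub> star V (M $$ ij))"
    by metis
  have entry: "M $$ ij \<in> carrier V" if "ij \<in> ?n" for ij
    using M that by (auto simp: mat_over_entry)
  define r where "r = sum R ?n"
  have r: "0 \<le> r" unfolding r_def by (intro sum_nonneg R)
  \<comment> \<open>\<open>r\<close> may be \<open>0\<close>, while an order unit bound asks for a
    strictly positive constant; hence \<open>r + 1\<close>.\<close>
  have "dominated ((r + 1) * (\<Sum>i<n. (cmod (c i))\<^sup>2)) (sesq V n M c c)" for c
  proof -
    let ?z = "\<lambda>ij. cnj (c (fst ij)) * c (snd ij)"
    define w where "w = sesq V n M c c"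
    define s where "s = (\<Sum>i<n. (cmod (c i))\<^sup>2)"
    have w: "w \<in> carrier V" unfolding w_def using M by simp
    have sesq: "w = finsum V (\<lambda>ij. ?z ij \<odot>\<^bsub>V\<^esub> M $$ ij) ?n"
      by (simp add: w_def sesq_def case_prod_unfold)
    have "star V w = finsum V (\<lambda>ij. cnj (?z ij) \<odot>\<^bsub>V\<^esub> star V (M $$ ij)) ?n"
      unfolding sesq
      by (subst star_finsum) (auto simp: entry star_smult star_closed intro!: finsum_cong')
    then have "w \<oplus> star V w =
        finsum V (\<lambda>ij. ?z ij \<odot>\<^bsub>V\<^esub> M $$ ij \<oplus> cnj (?z ij) \<odot>\<^bsub>V\<^esub> star V (M $$ ij)) ?n"
      unfolding sesq by (subst finsum_addf) (auto simp: entry star_closed)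
    moreover have "star V w = w" using herm[of c] by (simp add: w_def hermitian_def)
    moreover have "2 \<odot>\<^bsub>V\<^esub> w = w \<oplus> w" using smult_add_left[of w 1 1] w by simp
    moreover have "dominated (\<Sum>ij\<in>?n. cmod (?z ij) * R ij)
        (finsum V (\<lambda>ij. ?z ij \<odot>\<^bsub>V\<^esub> M $$ ij \<oplus> cnj (?z ij) \<odot>\<^bsub>V\<^esub> star V (M $$ ij)) ?n)"
      by (rule dominated_finsum[OF _ R(2)]) simp
    ultimately have "dominated (\<Sum>ij\<in>?n. cmod (?z ij) * R ij) (2 \<odot>\<^bsub>V\<^esub> w)"
      by (simp only:)
    then have "dominated (1/2 * (\<Sum>ij\<in>?n. cmod (?z ij) * R ij)) (complex_of_real (1/2) \<odot>\<^bsub>V\<^esub> (2 \<odot>\<^bsub>V\<^esub> w))"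
      by (rule dominated_smult) simp
    then have "dominated (1/2 * (\<Sum>ij\<in>?n. cmod (?z ij) * R ij)) w" using w by simp
    moreover have "1/2 * (\<Sum>ij\<in>?n. cmod (?z ij) * R ij) \<le> (r + 1) * s"
    proof -
      have s: "0 \<le> s" unfolding s_def by (intro sum_nonneg) auto
      have le: "cmod (?z ij) \<le> s" if "ij \<in> ?n" for ij
      proof -
        have "(cmod (c i))\<^sup>2 \<le> s" if "i < n" for i
          unfolding s_def using that by (intro member_le_sum) auto
        then have "(cmod (c (fst ij)))\<^sup>2 \<le> s" "(cmod (c (snd ij)))\<^sup>2 \<le> s" using that by auto
        \<comment> \<open>With \<open>a\<close> and \<open>b\<close> the two moduli, this yields
          \<open>2ab \<le> a^2 + b^2 \<le> 2s\<close>.\<close>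
        moreover have "0 \<le> (cmod (c (fst ij)) - cmod (c (snd ij)))\<^sup>2" by simp
        ultimately show ?thesis by (simp add: norm_mult power2_diff)
      qed
      have "(\<Sum>ij\<in>?n. cmod (?z ij) * R ij) \<le> (\<Sum>ij\<in>?n. s * R ij)"
        by (intro sum_mono mult_right_mono le R)
      also have "\<dots> = r * s" by (simp add: r_def sum_distrib_left mult.commute)
      finally show ?thesis using s mult_nonneg_nonneg[OF r s] unfolding distrib_right by linarith
    qed
    ultimately show ?thesis unfolding w_def s_def by (rule dominated_mono)
  qed
  then show ?thesis using r by (intro that[of "r + 1"]) auto
qed

text \<open>Each axiom is moved to the forms \<open>sesq V n M c c\<close>, where for fixed
  \<open>c\<close> it becomes the corresponding axiom of \<open>V\<close>. Only hermitian symmetry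
  and properness have to come back from forms to matrices, and the order unit needs a constant
  uniform in \<open>c\<close>.\<close>

lemma aou_space_matrix_level_OMIN: "aou_space (matrix_level (OMIN V) n)"
proof (rule aou_spaceI)
  have OMIN: "star_space (OMIN V)" by (rule star_space_cong[OF star_space_axioms]) simp_all
  then show "star_space (matrix_level (OMIN V) n)" by (rule star_space_matrix_level)
  have herm: "sesq V n M c c \<in> hermitian V" if "M \<in> hermitian (matrix_level (OMIN V) n)" for M c
    using that sesq_mat_star[of M n c c] by (auto simp: hermitian_def)
  have unit: "mat n n (\<lambda>(i, j). if i = j then ounit V else \<zero>) \<in> mat_over V n" by auto
  have smult: "mat n n (\<lambda>ij. c \<odot>\<^bsub>V\<^esub> M $$ ij) \<in> mat_over V n" if "M \<in> mat_over V n" for c M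
    using that by (auto simp: mat_over_entry)
  have add: "mat n n (\<lambda>ij. M $$ ij \<oplus> N $$ ij) \<in> mat_over V n"
    if "M \<in> mat_over V n" "N \<in> mat_over V n" for M N
    using that by (auto simp: mat_over_entry)
  {
    show "pcone (matrix_level (OMIN V) n) \<subseteq> hermitian (matrix_level (OMIN V) n)"
    proof
      fix M assume "M \<in> pcone (matrix_level (OMIN V) n)"
      then have M: "M \<in> mat_over V n" "\<And>c. sesq V n M c c \<in> pcone V" by (auto simp: mcone_OMIN)
      have "star V (sesq V n M c c) = sesq V n M c c" for c
        using M(2)[of c] pcone_hermitian by (auto simp: hermitian_def)
      then have "mat n n (\<lambda>(i, j). star V (M $$ (j, i))) = M"
        using M by (intro mat_eqI_sesq[of _ n]) (auto simp: sesq_mat_star star_closed mat_over_entry)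
      then show "M \<in> hermitian (matrix_level (OMIN V) n)" using M by (simp add: hermitian_def)
    qed
  next
    fix M N assume "M \<in> pcone (matrix_level (OMIN V) n)" "N \<in> pcone (matrix_level (OMIN V) n)"
    then show "M \<oplus>\<^bsub>matrix_level (OMIN V) n\<^esub> N \<in> pcone (matrix_level (OMIN V) n)"
      by (simp add: mcone_OMIN sesq_mat_add add pcone_add)
  next
    fix r :: real and M assume "0 \<le> r" "M \<in> pcone (matrix_level (OMIN V) n)"
    then show "complex_of_real r \<odot>\<^bsub>matrix_level (OMIN V) n\<^esub> M \<in> pcone (matrix_level (OMIN V) n)"
      by (simp add: mcone_OMIN sesq_mat_smult smult pcone_smult)
  next
    fix M assume "M \<in> pcone (matrix_level (OMIN V) n)"
      "(-1) \<odot>\<^bsub>matrix_level (OMIN V) n\<^esub> M \<in> pcone (matrix_level (OMIN V) n)"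
    then have M: "M \<in> mat_over V n" "\<And>c. sesq V n M c c = \<zero>"
      by (auto simp: mcone_OMIN sesq_mat_smult intro!: pcone_antisym)
    then have "M = mat n n (\<lambda>_. \<zero>)"
      by (intro mat_eqI_sesq[of _ n]) (auto simp: sesq_mat_zero)
    then show "M = \<zero>\<^bsub>matrix_level (OMIN V) n\<^esub>" by simp
  next
    show "ounit (matrix_level (OMIN V) n) \<in> pcone (matrix_level (OMIN V) n)"
      using unit by (simp add: mcone_OMIN sesq_mat_unit pcone_smult ounit_pcone sum_nonneg
          del: of_real_sum cong: if_cong)
  next
    fix M assume M: "M \<in> hermitian (matrix_level (OMIN V) n)"
    then have M': "M \<in> mat_over V n" by (simp add: hermitian_def)
    obtain r where r: "0 < r" "\<And>c. dominated (r * (\<Sum>i<n. (cmod (c i))\<^sup>2)) (sesq V n M c c)"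
      using sesq_hermitian_dominated[OF M' herm[OF M]] by blast
    show "\<exists>r>0. complex_of_real r \<odot>\<^bsub>matrix_level (OMIN V) n\<^esub> ounit (matrix_level (OMIN V) n)
      \<oplus>\<^bsub>matrix_level (OMIN V) n\<^esub> (-1) \<odot>\<^bsub>matrix_level (OMIN V) n\<^esub> M \<in> pcone (matrix_level (OMIN V) n)"
      using r unit M'
      by (intro exI[of _ r])
        (simp add: mcone_OMIN sesq_mat_add sesq_mat_smult add smult sesq_mat_unit dominated_def
          del: of_real_sum cong: if_cong)
  next
    fix M assume M: "M \<in> hermitian (matrix_level (OMIN V) n)"
      and pos: "\<And>r. r > 0 \<Longrightarrow> complex_of_real r \<odot>\<^bsub>matrix_level (OMIN V) n\<^esub> ounit (matrix_level (OMIN V) n)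
        \<oplus>\<^bsub>matrix_level (OMIN V) n\<^esub> M \<in> pcone (matrix_level (OMIN V) n)"
    have M': "M \<in> mat_over V n" using M by (simp add: hermitian_def)
    have "sesq V n M c c \<in> pcone V" for c
    proof (rule archimedeanI[OF herm[OF M]])
      fix r :: real assume r: "r > 0"
      let ?s = "\<Sum>i<n. (cmod (c i))\<^sup>2"
      have pos': "complex_of_real (t * ?s) \<odot>\<^bsub>V\<^esub> ounit V \<oplus> sesq V n M c c \<in> pcone V" if "t > 0" for t
        using pos[OF that] unit M'
        by (simp add: mcone_OMIN sesq_mat_add sesq_mat_smult add smult sesq_mat_unit
            del: of_real_sum cong: if_cong)
      show "complex_of_real r \<odot>\<^bsub>V\<^esub> ounit V \<oplus> sesq V n M c c \<in> pcone V"
      \<comment> \<open>The hypothesis at parameter \<open>t\<close> speaks of \<open>t * ?s\<close>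
        times the unit, so \<open>r\<close> is reached at \<open>t = r / ?s\<close>. For
        \<open>?s = 0\<close> the unit term vanishes and the value of the form is itself
        positive.\<close>
      proof (cases "?s = 0")
        case True
        then have "sesq V n M c c \<in> pcone V" using pos'[of 1] M' by simp
        then show ?thesis using r by (intro pcone_add pcone_smult ounit_pcone) auto
      next
        case False
        moreover have "0 \<le> ?s" by (intro sum_nonneg) auto
        ultimately show ?thesis using pos'[of "r / ?s"] r by simp
      qed
    qed
    then show "M \<in> pcone (matrix_level (OMIN V) n)" using M' by (simp add: mcone_OMIN)
  }
qed

lemma op_system_OMIN: "op_system (OMIN V)"
proof -
  interpret O: star_space "OMIN V" by (rule star_space_cong[OF star_space_axioms]) simp_all
  show ?thesis
    by (intro op_system.intro op_system_axioms.intro O.star_space_axioms)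
      (auto simp: mcone_OMIN aou_space_matrix_level_OMIN sesq_compress compress_mat_over)
qed

end

section \<open>Unital linear maps\<close>

lemma unital_linear_iff:
  "unital_linear V W f \<longleftrightarrow>
    (\<forall>x\<in>carrier V. f x \<in> carrier W) \<and>
    (\<forall>x\<in>carrier V. \<forall>y\<in>carrier V. f (x \<oplus>\<^bsub>V\<^esub> y) = f x \<oplus>\<^bsub>W\<^esub> f y) \<and>
    (\<forall>c. \<forall>x\<in>carrier V. f (c \<odot>\<^bsub>V\<^esub> x) = c \<odot>\<^bsub>W\<^esub> f x) \<and> f (ounit V) = ounit W"
  by (auto simp: unital_linear_def LinearCombinations.module_hom_def class_ring_simps)

lemma unital_linear_closed: "\<lbrakk>unital_linear V W f; x \<in> carrier V\<rbrakk> \<Longrightarrow> f x \<in> carrier W"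
  and unital_linear_add:
    "\<lbrakk>unital_linear V W f; x \<in> carrier V; y \<in> carrier V\<rbrakk> \<Longrightarrow> f (x \<oplus>\<^bsub>V\<^esub> y) = f x \<oplus>\<^bsub>W\<^esub> f y"
  and unital_linear_smult:
    "\<lbrakk>unital_linear V W f; x \<in> carrier V\<rbrakk> \<Longrightarrow> f (c \<odot>\<^bsub>V\<^esub> x) = c \<odot>\<^bsub>W\<^esub> f x"
  and unital_linear_ounit: "unital_linear V W f \<Longrightarrow> f (ounit V) = ounit W"
  by (simp_all add: unital_linear_iff)

lemma unital_linear_zero:
  assumes "star_space V" "star_space W" "unital_linear V W f"
  shows "f \<zero>\<^bsub>V\<^esub> = \<zero>\<^bsub>W\<^esub>"
proof -
  interpret V: star_space V by fact
  interpret W: star_space W by fact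
  have "f (0 \<odot>\<^bsub>V\<^esub> \<zero>\<^bsub>V\<^esub>) = 0 \<odot>\<^bsub>W\<^esub> f \<zero>\<^bsub>V\<^esub>"
    by (rule unital_linear_smult[OF assms(3)]) simp
  then show ?thesis using unital_linear_closed[OF assms(3) V.zero_closed] by simp
qed

lemma unital_linear_finsum:
  assumes "star_space V" "star_space W" "unital_linear V W f"
    and "finite A" "g \<in> A \<rightarrow> carrier V"
  shows "f (finsum V g A) = finsum W (\<lambda>i. f (g i)) A"
proof -
  interpret V: star_space V by fact
  interpret W: star_space W by fact
  show ?thesis
    using assms(4,5)
    by (induction A rule: finite_induct)
      (auto simp: unital_linear_zero[OF assms(1-3)] unital_linear_add[OF assms(3)]
        unital_linear_closed[OF assms(3)] Pi_def)
qed

text \<open>This is why OMIN turns positive maps into completely positive ones: the forms tested on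
  the image matrix are images of the forms tested on \<open>M\<close>.\<close>

lemma unital_linear_sesq:
  assumes "star_space V" "star_space W" "unital_linear V W f" and M: "M \<in> mat_over V n"
  shows "f (sesq V n M c d) = sesq W n (map_mat f M) c d"
proof -
  interpret V: star_space V by fact
  interpret W: star_space W by fact
  have "f (sesq V n M c d) =
      finsum W (\<lambda>ij. f (case ij of (i, j) \<Rightarrow> (cnj (c i) * d j) \<odot>\<^bsub>V\<^esub> M $$ (i, j))) ({..<n} \<times> {..<n})"
    unfolding sesq_def using M
    by (intro unital_linear_finsum assms) (auto simp: mat_over_entry)
  also have "\<dots> = sesq W n (map_mat f M) c d"
    unfolding sesq_def using M
    by (intro W.finsum_cong')
      (auto simp: mat_over_entry mat_over_dim unital_linear_smult[OF assms(3)]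
        unital_linear_closed[OF assms(3)])
  finally show ?thesis .
qed

lemma unital_linear_comp:
  "\<lbrakk>unital_linear V W f; unital_linear W X g\<rbrakk> \<Longrightarrow> unital_linear V X (\<lambda>x. g (f x))"
  by (simp add: unital_linear_iff)

text \<open>Agreement is known only on the carrier, so the unit must lie there for unitality to
  transfer.\<close>

lemma unital_linear_cong:
  assumes "star_space V" "ounit V \<in> carrier V"
    and "unital_linear V W f" "\<And>x. x \<in> carrier V \<Longrightarrow> f x = g x"
  shows "unital_linear V W g"
proof -
  interpret star_space V by fact
  show ?thesis using assms(2,3) by (simp add: unital_linear_iff flip: assms(4))
qed

lemma unital_positive_comp:
  "\<lbrakk>unital_positive V W f; unital_positive W X g\<rbrakk> \<Longrightarrow> unital_positive V X (\<lambda>x. g (f x))"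
  using unital_linear_comp by (auto simp: unital_positive_def)

lemma ucp_comp: "\<lbrakk>ucp A B f; ucp B C g\<rbrakk> \<Longrightarrow> ucp A C (\<lambda>x. g (f x))"
  unfolding ucp_def by (metis map_mat_map_mat unital_linear_comp)

lemma unital_order_embedding_comp:
  "\<lbrakk>unital_order_embedding V W f; unital_order_embedding W X g\<rbrakk> \<Longrightarrow>
    unital_order_embedding V X (\<lambda>x. g (f x))"
  unfolding unital_order_embedding_def
  by (auto intro: unital_linear_comp simp: unital_linear_closed inj_on_def)

text \<open>With \<open>r e - h\<close> positive, \<open>f h = r e - f (r e - h)\<close> is a
  difference of two hermitian elements.\<close>

lemma unital_positive_hermitian:
  assumes "aou_space V" "aou_space W" "unital_positive V W f" and h: "h \<in> hermitian V"
  shows "f h \<in> hermitian W"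
proof -
  interpret V: aou_space V by fact
  interpret W: aou_space W by fact
  have f: "unital_linear V W f" using assms(3) by (simp add: unital_positive_def)
  have hc: "h \<in> carrier V" using h by (simp add: hermitian_def)
  obtain r :: real where "complex_of_real r \<odot>\<^bsub>V\<^esub> ounit V \<oplus>\<^bsub>V\<^esub> (-1) \<odot>\<^bsub>V\<^esub> h \<in> pcone V"
    using V.order_unit_add[OF h] by blast
  then have "f (complex_of_real r \<odot>\<^bsub>V\<^esub> ounit V \<oplus>\<^bsub>V\<^esub> (-1) \<odot>\<^bsub>V\<^esub> h) \<in> pcone W"
    using assms(3) by (simp add: unital_positive_def)
  then have p: "complex_of_real r \<odot>\<^bsub>W\<^esub> ounit W \<oplus>\<^bsub>W\<^esub> (-1) \<odot>\<^bsub>W\<^esub> f h \<in> pcone W" (is "?p \<in> _")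
    using hc f by (simp add: unital_linear_iff)
  have fh: "f h \<in> carrier W" using unital_linear_closed[OF f hc] .
  have "complex_of_real r \<odot>\<^bsub>W\<^esub> ounit W \<oplus>\<^bsub>W\<^esub> complex_of_real (-1) \<odot>\<^bsub>W\<^esub> ?p \<in> hermitian W"
    using p W.pcone_hermitian
    by (intro W.hermitian_add[OF _ W.hermitian_smult] W.hermitian_smult W.ounit_hermitian) blast
  also have "complex_of_real r \<odot>\<^bsub>W\<^esub> ounit W \<oplus>\<^bsub>W\<^esub> complex_of_real (-1) \<odot>\<^bsub>W\<^esub> ?p =
      (complex_of_real r \<odot>\<^bsub>W\<^esub> ounit W \<oplus>\<^bsub>W\<^esub> (- complex_of_real r) \<odot>\<^bsub>W\<^esub> ounit W) \<oplus>\<^bsub>W\<^esub> f h"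
    using fh by (simp add: W.smult_add_right W.a_assoc)
  also have "\<dots> = f h" using fh by (simp flip: W.smult_add_left)
  finally show ?thesis .
qed

text \<open>The axioms of a unital positive map do not mention the involution; the order unit enforces it.\<close>

lemma unital_positive_star:
  assumes "aou_space V" "aou_space W" "unital_positive V W f" and x: "x \<in> carrier V"
  shows "f (star V x) = star W (f x)"
proof -
  interpret V: aou_space V by fact
  interpret W: aou_space W by fact
  have f: "unital_linear V W f" using assms(3) by (simp add: unital_positive_def)
  obtain a b where ab: "a \<in> hermitian V" "b \<in> hermitian V" "x = a \<oplus>\<^bsub>V\<^esub> \<i> \<odot>\<^bsub>V\<^esub> b"
    using V.cartesian_decomposition[OF x] .
  then have "f a \<in> hermitian W" "f b \<in> hermitian W"
    using unital_positive_hermitian[OF assms(1-3)] by auto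
  then show ?thesis
    using ab(1,2) f unfolding ab(3)
    by (simp add: hermitian_def V.star_add V.star_smult W.star_add W.star_smult unital_linear_iff)
qed

lemma unital_order_embedding_positive:
  assumes "aou_space V" "unital_order_embedding V W f"
  shows "unital_positive V W f"
  using assms aou_space.pcone_carrier[OF assms(1)]
  by (auto simp: unital_order_embedding_def unital_positive_def)

section \<open>The limit of a system of order embeddings\<close>

lemma inj_nat_times:
  assumes "infinite (UNIV :: 'a set)"
  obtains J :: "nat \<times> 'a \<Rightarrow> 'a" where "inj J"
proof -
  have "\<exists>f :: nat \<times> 'a \<Rightarrow> 'a. inj_on f (UNIV \<times> UNIV) \<and> f ` (UNIV \<times> UNIV) \<subseteq> UNIV"
    unfolding card_of_ordLeq
    using card_of_Times_infinite[OF assms, of "UNIV :: nat set"] assms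
    by (simp add: infinite_iff_card_of_nat ordIso_iff_ordLeq)
  then show ?thesis using that by auto
qed

text \<open>Infinitely many scalars act into a finite set, so two distinct ones agree on
  \<open>x\<close>, and their difference kills it.\<close>

lemma (in star_space) finite_carrier_imp_zero:
  assumes "finite (carrier V)" "x \<in> carrier V"
  shows "x = \<zero>"
proof -
  have "finite (range (\<lambda>c. c \<odot>\<^bsub>V\<^esub> x))"
    using assms by (intro finite_subset[OF _ assms(1)]) auto
  then have "\<not> inj (\<lambda>c. c \<odot>\<^bsub>V\<^esub> x)"
    using finite_imageD infinite_UNIV_char_0 by blast
  then obtain c d where cd: "c \<noteq> d" "c \<odot>\<^bsub>V\<^esub> x = d \<odot>\<^bsub>V\<^esub> x" by (auto simp: inj_def)
  have "(c + (- d)) \<odot>\<^bsub>V\<^esub> x = d \<odot>\<^bsub>V\<^esub> x \<oplus> (- d) \<odot>\<^bsub>V\<^esub> x"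
    using assms cd by (simp only: smult_add_left)
  also have "\<dots> = \<zero>" using assms by (simp flip: smult_add_left)
  finally show ?thesis by (rule smult_left_imp_zero) (use cd assms in auto)
qed

locale embedding_system =
  fixes V :: "nat \<Rightarrow> 'a aou_space" and \<phi> :: "nat \<Rightarrow> 'a \<Rightarrow> 'a"
  assumes aou: "aou_space (V k)"
    and embedding: "unital_order_embedding (V k) (V (Suc k)) (\<phi> k)"

text \<open>The union has to live in \<open>'a\<close> itself. The charts \<open>q k\<close> exist because an infinite \<open>'a\<close> has room
  for countably many copies of itself, while over a finite \<open>'a\<close> all spaces are zero.\<close>

locale embedding_charts = embedding_system +
  fixes q :: "nat \<Rightarrow> 'a \<Rightarrow> 'a"
  assumes q_inj: "inj_on (q k) (carrier (V k))"
    and q_Suc: "x \<in> carrier (V k) \<Longrightarrow> q (Suc k) (\<phi> k x) = q k x"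

lemma (in embedding_system) ex_charts: "\<exists>q. embedding_charts V \<phi> q"
proof (cases "finite (UNIV :: 'a set)")
  case True
  have "x = zero (V k)" if "x \<in> carrier (V k)" for k x
  proof -
    interpret aou_space "V k" by (rule aou)
    show ?thesis by (rule finite_carrier_imp_zero[OF finite_subset[OF subset_UNIV True] that])
  qed
  \<comment> \<open>On carriers with at most one element, constant charts are injective.\<close>
  then have "inj_on (\<lambda>_. undefined) (carrier (V k))" for k by (metis inj_onI)
  then have "embedding_charts V \<phi> (\<lambda>_ _. undefined)" by unfold_locales auto
  then show ?thesis by blast
next
  case False
  then obtain J :: "nat \<times> 'a \<Rightarrow> 'a" where J: "inj J" using inj_nat_times by blast
  \<comment> \<open>An element that comes from the previous level keeps its old label; a new element
    \<open>y\<close> of level \<open>Suc k\<close> gets the fresh label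
    \<open>J (Suc k, y)\<close>.\<close>
  define q where "q = rec_nat (\<lambda>x. J (0, x)) (\<lambda>k qk y.
    if y \<in> \<phi> k ` carrier (V k) then qk (inv_into (carrier (V k)) (\<phi> k) y) else J (Suc k, y))"
  have q0: "q 0 x = J (0, x)" for x by (simp add: q_def)
  have qS: "q (Suc k) y = (if y \<in> \<phi> k ` carrier (V k)
      then q k (inv_into (carrier (V k)) (\<phi> k) y) else J (Suc k, y))" for k y
    by (simp add: q_def)
  have inj: "inj_on (\<phi> k) (carrier (V k))" for k
    using embedding[of k] by (simp add: unital_order_embedding_def)
  \<comment> \<open>The bound on the tags used up to level \<open>k\<close> is carried through the
    induction because it keeps fresh labels apart from old ones.\<close>
  have q: "inj_on (q k) (carrier (V k)) \<and> q k ` carrier (V k) \<subseteq> J ` ({..k} \<times> UNIV)" for k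
  proof (induction k)
    case 0
    show ?case using J by (auto simp: q0 inj_on_def)
  next
    case (Suc k)
    have old: "q (Suc k) y \<in> J ` ({..k} \<times> UNIV)" if "y \<in> \<phi> k ` carrier (V k)" for y
      using Suc that inv_into_into[OF that] by (auto simp: qS)
    have new: "q (Suc k) y \<notin> J ` ({..k} \<times> UNIV)" if "y \<notin> \<phi> k ` carrier (V k)" for y
      using that J by (auto simp: qS dest: injD)
    have "y = z" if eq: "q (Suc k) y = q (Suc k) z" for y z
    proof (cases "y \<in> \<phi> k ` carrier (V k)")
      case True
      then have z: "z \<in> \<phi> k ` carrier (V k)" using old new eq by metis
      obtain a b where ab: "a \<in> carrier (V k)" "b \<in> carrier (V k)" "y = \<phi> k a" "z = \<phi> k b"
        using True z by blast
      then have "q k a = q k b" using eq inj by (simp add: qS)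
      then show ?thesis using Suc ab by (auto dest: inj_onD)
    next
      case False
      then have "z \<notin> \<phi> k ` carrier (V k)" using old new eq by metis
      then show ?thesis using False eq J by (auto simp: qS dest: injD)
    qed
    moreover have "q (Suc k) y \<in> J ` ({..Suc k} \<times> UNIV)" for y
      using old[of y] by (cases "y \<in> \<phi> k ` carrier (V k)") (fastforce simp: qS)+
    ultimately show ?case by (auto intro: inj_onI)
  qed
  have "embedding_charts V \<phi> q"
    using q inj by unfold_locales (auto simp: qS)
  then show ?thesis by blast
qed

section \<open>Independence of the level, and the union of all levels\<close>

context embedding_charts
begin

lemma star_space_V: "star_space (V k)"
  using aou[of k] by (rule aou_space.axioms)

text \<open>\<open>f\<close> is the composite of the maps between levels \<open>k\<close> and
  \<open>l\<close>. Its effect on labels determines it on the carrier, since \<open>q l\<close> is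
  injective there.\<close>

lemma transition:
  assumes "k \<le> l"
  shows "\<exists>f. unital_order_embedding (V k) (V l) f \<and> (\<forall>x\<in>carrier (V k). q l (f x) = q k x)"
  using assms
proof (induction l rule: dec_induct)
  case base
  have "unital_order_embedding (V k) (V k) (\<lambda>x. x)"
    by (auto simp: unital_order_embedding_def unital_linear_iff)
  then show ?case by auto
next
  case (step l)
  then obtain f where f: "unital_order_embedding (V k) (V l) f" "\<forall>x\<in>carrier (V k). q l (f x) = q k x"
    by blast
  moreover have "f x \<in> carrier (V l)" if "x \<in> carrier (V k)" for x
    using f that by (auto simp: unital_order_embedding_def unital_linear_closed)
  ultimately show ?case
    using unital_order_embedding_comp[OF f(1) embedding] by (auto simp: q_Suc)
qed

lemma lift:
  "\<lbrakk>k \<le> l; x \<in> carrier (V k)\<rbrakk> \<Longrightarrow> \<exists>y\<in>carrier (V l). q k x = q l y"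
  using transition[of k l] unfolding unital_order_embedding_def by (metis unital_linear_closed)

text \<open>At level \<open>max k k'\<close> the chart is injective, so equal labels become equal
  elements. Identities between operations at two levels can thus be checked inside one
  space.\<close>

lemma common_level:
  assumes "x \<in> carrier (V k)" "x' \<in> carrier (V k')" "q k x = q k' x'"
  obtains l f f' where "unital_order_embedding (V k) (V l) f" "unital_order_embedding (V k') (V l) f'"
    "\<And>y. y \<in> carrier (V k) \<Longrightarrow> q k y = q l (f y)" "\<And>y. y \<in> carrier (V k') \<Longrightarrow> q k' y = q l (f' y)"
    "\<And>y y'. \<lbrakk>y \<in> carrier (V k); y' \<in> carrier (V k'); q k y = q k' y'\<rbrakk> \<Longrightarrow> f y = f' y'"
proof -
  let ?l = "max k k'"
  obtain f where f: "unital_order_embedding (V k) (V ?l) f" "\<forall>x\<in>carrier (V k). q ?l (f x) = q k x"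
    using transition[of k ?l] by auto
  obtain f' where f': "unital_order_embedding (V k') (V ?l) f'" "\<forall>x\<in>carrier (V k'). q ?l (f' x) = q k' x"
    using transition[of k' ?l] by auto
  have "f y = f' y'" if y: "y \<in> carrier (V k)" "y' \<in> carrier (V k')" "q k y = q k' y'" for y y'
  proof (rule inj_onD[OF q_inj])
    show "q ?l (f y) = q ?l (f' y')" using f f' y by simp
  qed (use f f' y in \<open>auto simp: unital_order_embedding_def unital_linear_closed\<close>)
  then show ?thesis using f f' by (intro that[of ?l f f']) auto
qed

lemma coherent_add:
  assumes "x \<in> carrier (V k)" "y \<in> carrier (V k)" "x' \<in> carrier (V k')" "y' \<in> carrier (V k')"
    "q k x = q k' x'" "q k y = q k' y'"
  shows "q k (x \<oplus>\<^bsub>V k\<^esub> y) = q k' (x' \<oplus>\<^bsub>V k'\<^esub> y')"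
proof -
  interpret k: star_space "V k" by (rule star_space_V)
  interpret k': star_space "V k'" by (rule star_space_V)
  show ?thesis
  proof (rule common_level[OF assms(1,3,5)])
    fix l f f'
    assume "unital_order_embedding (V k) (V l) f" "unital_order_embedding (V k') (V l) f'"
      and q: "\<And>y. y \<in> carrier (V k) \<Longrightarrow> q k y = q l (f y)"
        "\<And>y. y \<in> carrier (V k') \<Longrightarrow> q k' y = q l (f' y)"
      and eq: "\<And>y y'. \<lbrakk>y \<in> carrier (V k); y' \<in> carrier (V k'); q k y = q k' y'\<rbrakk> \<Longrightarrow> f y = f' y'"
    then have "unital_linear (V k) (V l) f" "unital_linear (V k') (V l) f'"
      by (auto simp: unital_order_embedding_def)
    then have "f (x \<oplus>\<^bsub>V k\<^esub> y) = f' (x' \<oplus>\<^bsub>V k'\<^esub> y')"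
      using eq[OF assms(1,3,5)] eq[OF assms(2,4,6)] assms(1-4) by (simp add: unital_linear_add)
    then show ?thesis using q(1)[of "x \<oplus>\<^bsub>V k\<^esub> y"] q(2)[of "x' \<oplus>\<^bsub>V k'\<^esub> y'"] assms(1-4) by simp
  qed
qed

lemma coherent_smult:
  assumes "x \<in> carrier (V k)" "x' \<in> carrier (V k')" "q k x = q k' x'"
  shows "q k (c \<odot>\<^bsub>V k\<^esub> x) = q k' (c \<odot>\<^bsub>V k'\<^esub> x')"
proof -
  interpret k: star_space "V k" by (rule star_space_V)
  interpret k': star_space "V k'" by (rule star_space_V)
  show ?thesis
  proof (rule common_level[OF assms])
    fix l f f'
    assume "unital_order_embedding (V k) (V l) f" "unital_order_embedding (V k') (V l) f'"
      and q: "\<And>y. y \<in> carrier (V k) \<Longrightarrow> q k y = q l (f y)"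
        "\<And>y. y \<in> carrier (V k') \<Longrightarrow> q k' y = q l (f' y)"
      and eq: "\<And>y y'. \<lbrakk>y \<in> carrier (V k); y' \<in> carrier (V k'); q k y = q k' y'\<rbrakk> \<Longrightarrow> f y = f' y'"
    then have "unital_linear (V k) (V l) f" "unital_linear (V k') (V l) f'"
      by (auto simp: unital_order_embedding_def)
    then have "f (c \<odot>\<^bsub>V k\<^esub> x) = f' (c \<odot>\<^bsub>V k'\<^esub> x')"
      using eq[OF assms] assms(1,2) by (simp add: unital_linear_smult)
    then show ?thesis using q(1)[of "c \<odot>\<^bsub>V k\<^esub> x"] q(2)[of "c \<odot>\<^bsub>V k'\<^esub> x'"] assms(1,2) by simp
  qed
qed

text \<open>The transition maps respect the involution because they are positive
  (\<open>unital_positive_star\<close>); linearity alone would not do.\<close>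

lemma coherent_star:
  assumes "x \<in> carrier (V k)" "x' \<in> carrier (V k')" "q k x = q k' x'"
  shows "q k (star (V k) x) = q k' (star (V k') x')"
proof -
  interpret k: star_space "V k" by (rule star_space_V)
  interpret k': star_space "V k'" by (rule star_space_V)
  show ?thesis
  proof (rule common_level[OF assms])
    fix l f f'
    assume "unital_order_embedding (V k) (V l) f" "unital_order_embedding (V k') (V l) f'"
      and q: "\<And>y. y \<in> carrier (V k) \<Longrightarrow> q k y = q l (f y)"
        "\<And>y. y \<in> carrier (V k') \<Longrightarrow> q k' y = q l (f' y)"
      and eq: "\<And>y y'. \<lbrakk>y \<in> carrier (V k); y' \<in> carrier (V k'); q k y = q k' y'\<rbrakk> \<Longrightarrow> f y = f' y'"
    then have "unital_positive (V k) (V l) f" "unital_positive (V k') (V l) f'"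
      by (auto intro: unital_order_embedding_positive aou)
    then have "f (star (V k) x) = f' (star (V k') x')"
      using eq[OF assms] assms(1,2) by (simp add: unital_positive_star[OF aou aou])
    then show ?thesis
      using q(1)[of "star (V k) x"] q(2)[of "star (V k') x'"] assms(1,2)
      by (simp add: k.star_closed k'.star_closed)
  qed
qed

lemma coherent_zero: "q k \<zero>\<^bsub>V k\<^esub> = q l \<zero>\<^bsub>V l\<^esub>"
proof -
  have *: "q k \<zero>\<^bsub>V k\<^esub> = q l \<zero>\<^bsub>V l\<^esub>" if kl: "k \<le> l" for k l
  proof -
    interpret k: star_space "V k" by (rule star_space_V)
    obtain f where f: "unital_linear (V k) (V l) f" "\<forall>x\<in>carrier (V k). q l (f x) = q k x"
      using transition[OF kl] by (auto simp: unital_order_embedding_def)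
    show ?thesis
      using bspec[OF f(2) k.zero_closed] unital_linear_zero[OF star_space_V star_space_V f(1)] by simp
  qed
  show ?thesis using nat_le_linear[of k l] by (elim disjE) (rule *, assumption, rule *[symmetric])
qed

lemma coherent_ounit: "q k (ounit (V k)) = q l (ounit (V l))"
proof -
  have *: "q k (ounit (V k)) = q l (ounit (V l))" if kl: "k \<le> l" for k l
  proof -
    interpret k: aou_space "V k" by (rule aou)
    obtain f where f: "unital_linear (V k) (V l) f" "\<forall>x\<in>carrier (V k). q l (f x) = q k x"
      using transition[OF kl] by (auto simp: unital_order_embedding_def)
    show ?thesis
      using bspec[OF f(2) k.ounit_carrier] unital_linear_ounit[OF f(1)] by simp
  qed
  show ?thesis using nat_le_linear[of k l] by (elim disjE) (rule *, assumption, rule *[symmetric])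
qed

text \<open>The decisive use of order embedding: positivity is reflected as well as preserved, so it
  does not depend on the level at which an element is represented.\<close>

lemma coherent_pcone:
  assumes "x \<in> carrier (V k)" "x' \<in> carrier (V k')" "q k x = q k' x'"
  shows "x \<in> pcone (V k) \<longleftrightarrow> x' \<in> pcone (V k')"
proof (rule common_level[OF assms])
  fix l f f'
  assume f: "unital_order_embedding (V k) (V l) f" "unital_order_embedding (V k') (V l) f'"
    and eq: "\<And>y y'. \<lbrakk>y \<in> carrier (V k); y' \<in> carrier (V k'); q k y = q k' y'\<rbrakk> \<Longrightarrow> f y = f' y'"
  show ?thesis using f eq[OF assms] assms(1,2) by (simp add: unital_order_embedding_def)
qed

text \<open>The directed union of the levels, with no quotient and no Archimedean closure of the
  cone. The operations are taken by \<open>THE\<close> over all representatives; the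
  \<open>coherent_\<close> lemmas show that the value does not depend on them. Zero and unit are
  those of level 0.\<close>

definition glued :: "'a aou_space" where
  "glued =
     \<lparr>carrier = (\<Union>k. q k ` carrier (V k)), mult = undefined, one = undefined,
      zero = q 0 \<zero>\<^bsub>V 0\<^esub>,
      add = (\<lambda>a b. THE c. \<exists>k. \<exists>x\<in>carrier (V k). \<exists>y\<in>carrier (V k).
        a = q k x \<and> b = q k y \<and> c = q k (x \<oplus>\<^bsub>V k\<^esub> y)),
      smult = (\<lambda>z a. THE c. \<exists>k. \<exists>x\<in>carrier (V k). a = q k x \<and> c = q k (z \<odot>\<^bsub>V k\<^esub> x)),
      star = (\<lambda>a. THE c. \<exists>k. \<exists>x\<in>carrier (V k). a = q k x \<and> c = q k (star (V k) x)),
      ounit = q 0 (ounit (V 0)),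
      pcone = (\<Union>k. q k ` pcone (V k))\<rparr>"

lemma glued_closed [simp, intro]: "x \<in> carrier (V k) \<Longrightarrow> q k x \<in> carrier glued"
  by (auto simp: glued_def)

lemma glued_zero: "\<zero>\<^bsub>glued\<^esub> = q k \<zero>\<^bsub>V k\<^esub>"
  by (simp add: glued_def coherent_zero[of 0 k])

lemma glued_ounit: "ounit glued = q k (ounit (V k))"
  by (simp add: glued_def coherent_ounit[of 0 k])

lemma glued_add:
  assumes "x \<in> carrier (V k)" "y \<in> carrier (V k)"
  shows "q k x \<oplus>\<^bsub>glued\<^esub> q k y = q k (x \<oplus>\<^bsub>V k\<^esub> y)"
  unfolding glued_def ring.simps
proof (rule the_equality)
  fix c assume "\<exists>l. \<exists>x'\<in>carrier (V l). \<exists>y'\<in>carrier (V l). q k x = q l x' \<and> q k y = q l y' \<and> c = q l (x' \<oplus>\<^bsub>V l\<^esub> y')"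
  then obtain l x' y' where "x' \<in> carrier (V l)" "y' \<in> carrier (V l)" "q k x = q l x'" "q k y = q l y'"
    "c = q l (x' \<oplus>\<^bsub>V l\<^esub> y')" by blast
  then show "c = q k (x \<oplus>\<^bsub>V k\<^esub> y)" using assms coherent_add[of x k y x' l y'] by simp
qed (use assms in blast)

lemma glued_smult:
  assumes "x \<in> carrier (V k)"
  shows "z \<odot>\<^bsub>glued\<^esub> q k x = q k (z \<odot>\<^bsub>V k\<^esub> x)"
  unfolding glued_def module.simps
proof (rule the_equality)
  fix c assume "\<exists>l. \<exists>x'\<in>carrier (V l). q k x = q l x' \<and> c = q l (z \<odot>\<^bsub>V l\<^esub> x')"
  then obtain l x' where "x' \<in> carrier (V l)" "q k x = q l x'" "c = q l (z \<odot>\<^bsub>V l\<^esub> x')" by blast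
  then show "c = q k (z \<odot>\<^bsub>V k\<^esub> x)" using assms coherent_smult[of x k x' l z] by simp
qed (use assms in blast)

lemma glued_star:
  assumes "x \<in> carrier (V k)"
  shows "star glued (q k x) = q k (star (V k) x)"
  unfolding glued_def star_space.simps
proof (rule the_equality)
  fix c assume "\<exists>l. \<exists>x'\<in>carrier (V l). q k x = q l x' \<and> c = q l (star (V l) x')"
  then obtain l x' where "x' \<in> carrier (V l)" "q k x = q l x'" "c = q l (star (V l) x')" by blast
  then show "c = q k (star (V k) x)" using assms coherent_star[of x k x' l] by simp
qed (use assms in blast)

text \<open>The positive representative of \<open>q k x\<close> may sit at another level
  \<open>l\<close>; \<open>coherent_pcone\<close> carries its positivity over to
  \<open>x\<close>.\<close>

lemma glued_pcone:
  assumes x: "x \<in> carrier (V k)"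
  shows "q k x \<in> pcone glued \<longleftrightarrow> x \<in> pcone (V k)"
proof
  assume "q k x \<in> pcone glued"
  then obtain l y where y: "y \<in> pcone (V l)" "q k x = q l y" by (auto simp: glued_def)
  then show "x \<in> pcone (V k)"
    using coherent_pcone[OF x aou_space.pcone_carrier[OF aou y(1)] y(2)] by blast
qed (auto simp: glued_def)

lemma glued_cases:
  assumes "a \<in> carrier glued"
  obtains k x where "x \<in> carrier (V k)" "a = q k x"
  using assms by (auto simp: glued_def)

lemma glued_cases2:
  assumes "a \<in> carrier glued" "b \<in> carrier glued"
  obtains k x y where "x \<in> carrier (V k)" "y \<in> carrier (V k)" "a = q k x" "b = q k y"
proof -
  obtain k x l y where kl: "x \<in> carrier (V k)" "a = q k x" "y \<in> carrier (V l)" "b = q l y"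
    using glued_cases[OF assms(1)] glued_cases[OF assms(2)] by metis
  then show ?thesis
    using lift[of k "max k l" x] lift[of l "max k l" y] that by auto
qed

lemma glued_cases3:
  assumes "a \<in> carrier glued" "b \<in> carrier glued" "c \<in> carrier glued"
  obtains k x y z where "x \<in> carrier (V k)" "y \<in> carrier (V k)" "z \<in> carrier (V k)"
    "a = q k x" "b = q k y" "c = q k z"
proof -
  obtain k x y l z where kl: "x \<in> carrier (V k)" "a = q k x" "y \<in> carrier (V k)" "b = q k y"
    "z \<in> carrier (V l)" "c = q l z"
    using glued_cases2[OF assms(1,2)] glued_cases[OF assms(3)] by metis
  then show ?thesis
    using lift[of k "max k l" x] lift[of k "max k l" y] lift[of l "max k l" z] that by auto
qed

lemma star_space_glued: "star_space glued"
proof (rule star_spaceI)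
  show "\<zero>\<^bsub>glued\<^esub> \<in> carrier glued"
  proof -
    interpret star_space "V 0" by (rule star_space_V)
    show ?thesis by (simp add: glued_zero[of 0])
  qed
next
  fix a b assume "a \<in> carrier glued" "b \<in> carrier glued"
  then obtain k x y where xy: "x \<in> carrier (V k)" "y \<in> carrier (V k)" "a = q k x" "b = q k y"
    by (rule glued_cases2)
  interpret star_space "V k" by (rule star_space_V)
  show "a \<oplus>\<^bsub>glued\<^esub> b \<in> carrier glued" "a \<oplus>\<^bsub>glued\<^esub> b = b \<oplus>\<^bsub>glued\<^esub> a"
    "c \<odot>\<^bsub>glued\<^esub> (a \<oplus>\<^bsub>glued\<^esub> b) = c \<odot>\<^bsub>glued\<^esub> a \<oplus>\<^bsub>glued\<^esub> c \<odot>\<^bsub>glued\<^esub> b" for c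
    using xy by (simp_all add: glued_add glued_smult smult_add_right a_comm)
next
  fix a b c assume "a \<in> carrier glued" "b \<in> carrier glued" "c \<in> carrier glued"
  then obtain k x y z where xyz: "x \<in> carrier (V k)" "y \<in> carrier (V k)" "z \<in> carrier (V k)"
    "a = q k x" "b = q k y" "c = q k z"
    by (rule glued_cases3)
  interpret star_space "V k" by (rule star_space_V)
  show "a \<oplus>\<^bsub>glued\<^esub> b \<oplus>\<^bsub>glued\<^esub> c = a \<oplus>\<^bsub>glued\<^esub> (b \<oplus>\<^bsub>glued\<^esub> c)"
    using xyz by (simp add: glued_add a_assoc)
next
  fix a assume "a \<in> carrier glued"
  then obtain k x where x: "x \<in> carrier (V k)" "a = q k x" by (rule glued_cases)
  interpret star_space "V k" by (rule star_space_V)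
  show "c \<odot>\<^bsub>glued\<^esub> a \<in> carrier glued" "1 \<odot>\<^bsub>glued\<^esub> a = a" "0 \<odot>\<^bsub>glued\<^esub> a = \<zero>\<^bsub>glued\<^esub>"
    "(c * d) \<odot>\<^bsub>glued\<^esub> a = c \<odot>\<^bsub>glued\<^esub> (d \<odot>\<^bsub>glued\<^esub> a)"
    "(c + d) \<odot>\<^bsub>glued\<^esub> a = c \<odot>\<^bsub>glued\<^esub> a \<oplus>\<^bsub>glued\<^esub> d \<odot>\<^bsub>glued\<^esub> a" for c d
    using x by (simp_all add: glued_add glued_smult glued_zero[of k] smult_add_left)
next
  show "star_space_axioms glued"
  proof
    fix a assume "a \<in> carrier glued"
    then obtain k x where x: "x \<in> carrier (V k)" "a = q k x" by (rule glued_cases)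
    interpret star_space "V k" by (rule star_space_V)
    show "star glued a \<in> carrier glued" "star glued (star glued a) = a"
      "star glued (c \<odot>\<^bsub>glued\<^esub> a) = cnj c \<odot>\<^bsub>glued\<^esub> star glued a" for c
      using x by (simp_all add: glued_smult glued_star star_closed star_star star_smult)
  next
    fix a b assume "a \<in> carrier glued" "b \<in> carrier glued"
    then obtain k x y where xy: "x \<in> carrier (V k)" "y \<in> carrier (V k)" "a = q k x" "b = q k y"
      by (rule glued_cases2)
    interpret star_space "V k" by (rule star_space_V)
    show "star glued (a \<oplus>\<^bsub>glued\<^esub> b) = star glued a \<oplus>\<^bsub>glued\<^esub> star glued b"
      using xy by (simp add: glued_add glued_star star_closed star_add)
  qed
qed

lemma glued_hermitian: "x \<in> carrier (V k) \<Longrightarrow> q k x \<in> hermitian glued \<longleftrightarrow> x \<in> hermitian (V k)"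
  using star_space.star_closed[OF star_space_V, of x k] inj_onD[OF q_inj[of k]]
  by (auto simp: hermitian_def glued_star)

lemma glued_pcone_carrier: "a \<in> pcone glued \<Longrightarrow> a \<in> carrier glued"
  using aou_space.pcone_carrier[OF aou] by (auto simp: glued_def)

text \<open>Most axioms concern finitely many elements, which share a level \<open>k\<close>. The
  Archimedean axiom also stays at the level of \<open>a\<close>: the unit is represented at every
  level, and \<open>glued_pcone\<close> pulls the positivity statements for all \<open>r\<close>
  back to the same \<open>k\<close>. With merely positive maps each \<open>r\<close> might need a
  later level.\<close>

lemma aou_space_glued: "aou_space glued"
proof (rule aou_spaceI)
  show "star_space glued" by (rule star_space_glued)
next
  show "pcone glued \<subseteq> hermitian glued"
  proof
    fix a assume a: "a \<in> pcone glued"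
    then have "a \<in> carrier glued" by (simp add: glued_pcone_carrier)
  then obtain k x where x: "x \<in> carrier (V k)" "a = q k x" by (rule glued_cases)
    then show "a \<in> hermitian glued"
      using a aou_space.pcone_hermitian[OF aou[of k]] by (auto simp: glued_pcone glued_hermitian)
  qed
next
  fix a b assume ab: "a \<in> pcone glued" "b \<in> pcone glued"
  obtain k x y where xy: "x \<in> carrier (V k)" "y \<in> carrier (V k)" "a = q k x" "b = q k y"
    using glued_cases2[OF glued_pcone_carrier[OF ab(1)] glued_pcone_carrier[OF ab(2)]] by metis
  interpret aou_space "V k" by (rule aou)
  show "a \<oplus>\<^bsub>glued\<^esub> b \<in> pcone glued"
    using ab xy by (simp add: glued_add glued_pcone pcone_add)
next
  fix r :: real and a assume a: "0 \<le> r" "a \<in> pcone glued"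
  then have "a \<in> carrier glued" by (simp add: glued_pcone_carrier)
  then obtain k x where x: "x \<in> carrier (V k)" "a = q k x" by (rule glued_cases)
  interpret aou_space "V k" by (rule aou)
  show "complex_of_real r \<odot>\<^bsub>glued\<^esub> a \<in> pcone glued"
    using a x by (simp add: glued_smult glued_pcone pcone_smult)
next
  fix a assume a: "a \<in> pcone glued" "(-1) \<odot>\<^bsub>glued\<^esub> a \<in> pcone glued"
  then have "a \<in> carrier glued" by (simp add: glued_pcone_carrier)
  then obtain k x where x: "x \<in> carrier (V k)" "a = q k x" by (rule glued_cases)
  interpret aou_space "V k" by (rule aou)
  show "a = \<zero>\<^bsub>glued\<^esub>"
    using a x pcone_antisym[of x] by (simp add: glued_smult glued_pcone glued_zero[of k])
next
  interpret aou_space "V 0" by (rule aou)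
  show "ounit glued \<in> pcone glued"
    using ounit_pcone by (simp add: glued_ounit[of 0] glued_pcone)
next
  fix a assume a: "a \<in> hermitian glued"
  then have "a \<in> carrier glued" by (rule star_space.hermitianD(1)[OF star_space_glued])
  then obtain k x where x: "x \<in> carrier (V k)" "a = q k x" by (rule glued_cases)
  interpret aou_space "V k" by (rule aou)
  show "\<exists>r>0. complex_of_real r \<odot>\<^bsub>glued\<^esub> ounit glued \<oplus>\<^bsub>glued\<^esub> (-1) \<odot>\<^bsub>glued\<^esub> a \<in> pcone glued"
    using a x order_unit_add[of x]
    by (simp add: glued_hermitian glued_ounit[of k] glued_smult glued_add glued_pcone)
next
  fix a assume a: "a \<in> hermitian glued"
    and pos: "\<And>r. 0 < r \<Longrightarrow> complex_of_real r \<odot>\<^bsub>glued\<^esub> ounit glued \<oplus>\<^bsub>glued\<^esub> a \<in> pcone glued"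
  have "a \<in> carrier glued" using a by (rule star_space.hermitianD(1)[OF star_space_glued])
  then obtain k x where x: "x \<in> carrier (V k)" "a = q k x" by (rule glued_cases)
  interpret aou_space "V k" by (rule aou)
  have "complex_of_real r \<odot>\<^bsub>V k\<^esub> ounit (V k) \<oplus>\<^bsub>V k\<^esub> x \<in> pcone (V k)" if "r > 0" for r
    using pos[OF that] x by (simp add: glued_ounit[of k] glued_smult glued_add glued_pcone)
  moreover have "x \<in> hermitian (V k)" using a x by (simp add: glued_hermitian)
  ultimately show "a \<in> pcone glued" using x by (simp add: archimedeanI glued_pcone)
qed

lemma unital_positive_q: "unital_positive (V k) glued (q k)"
  using aou_space.pcone_carrier[OF aou[of k]]
  by (auto simp: unital_positive_def unital_linear_iff glued_add glued_smult glued_ounit[of k] glued_pcone)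

lemma cocone_glued: "cocone aou_space unital_positive V \<phi> glued q"
  by (simp add: cocone_def aou_space_glued unital_positive_q q_Suc)

text \<open>The map is read off any representative, which requires \<open>\<psi>\<close> to agree on
  equal labels. Existence is enough for the comparison with \<open>L\<close>, where uniqueness comes
  from \<open>L\<close> itself.\<close>

lemma ex_mediator:
  assumes "cocone aou_space unital_positive V \<phi> W \<psi>"
  shows "\<exists>w. mediates unital_positive V glued q W \<psi> w"
proof -
  interpret W: aou_space W using assms by (simp add: cocone_def)
  have \<psi>: "unital_positive (V k) W (\<psi> k)" for k using assms by (simp add: cocone_def)
  have \<psi>': "unital_linear (V k) W (\<psi> k)" for k using \<psi> by (simp add: unital_positive_def)
  have \<psi>_Suc: "\<psi> (Suc k) (\<phi> k x) = \<psi> k x" if "x \<in> carrier (V k)" for k x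
    using assms that by (simp add: cocone_def)
  have up: "\<psi> l y = \<psi> k x"
    if "k \<le> l" and x: "x \<in> carrier (V k)" and "y \<in> carrier (V l)" "q l y = q k x" for k l x y
    using that(1,3,4)
  proof (induction l arbitrary: y rule: dec_induct)
    case base
    show ?case using inj_onD[OF q_inj base.prems(2,1) x] by simp
  next
    case (step l)
    \<comment> \<open>\<open>y\<close> has the label of an element \<open>z\<close> of level
      \<open>l\<close>, so injectivity of the chart makes it \<open>\<phi> l z\<close>, and the
      cocone law applies.\<close>
    obtain z where z: "z \<in> carrier (V l)" "q l z = q k x" using lift[OF step.hyps(1) x] by metis
    have "unital_linear (V l) (V (Suc l)) (\<phi> l)"
      using embedding by (simp add: unital_order_embedding_def)
    then have "\<phi> l z \<in> carrier (V (Suc l))" using z(1) by (rule unital_linear_closed)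
    moreover have "q (Suc l) y = q (Suc l) (\<phi> l z)" using step.prems z by (simp add: q_Suc)
    ultimately have "y = \<phi> l z" using inj_onD[OF q_inj] step.prems(1) by metis
    then show ?case using step.IH[OF z] z(1) by (simp add: \<psi>_Suc)
  qed
  have coherent: "\<psi> k x = \<psi> l y"
    if "x \<in> carrier (V k)" "y \<in> carrier (V l)" "q k x = q l y" for k l x y
    using up[of k l x y] up[of l k y x] that nat_le_linear[of k l] by metis
  define w where "w a = (THE c. \<exists>k. \<exists>x\<in>carrier (V k). a = q k x \<and> c = \<psi> k x)" for a
  have w: "w (q k x) = \<psi> k x" if "x \<in> carrier (V k)" for k x
    unfolding w_def
  proof (rule the_equality)
    fix c assume "\<exists>l. \<exists>x'\<in>carrier (V l). q k x = q l x' \<and> c = \<psi> l x'"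
    then obtain l x' where "x' \<in> carrier (V l)" "q k x = q l x'" "c = \<psi> l x'" by blast
    then show "c = \<psi> k x" using that coherent[of x k x' l] by simp
  qed (use that in blast)
  have "unital_linear glued W w"
    unfolding unital_linear_iff
  proof (intro conjI ballI allI)
    fix a assume "a \<in> carrier glued"
    then obtain k x where x: "x \<in> carrier (V k)" "a = q k x" by (rule glued_cases)
    interpret star_space "V k" by (rule star_space_V)
    show "w a \<in> carrier W" "w (c \<odot>\<^bsub>glued\<^esub> a) = c \<odot>\<^bsub>W\<^esub> w a" for c
      using x by (simp_all add: w glued_smult unital_linear_closed[OF \<psi>'] unital_linear_smult[OF \<psi>'])
  next
    fix a b assume "a \<in> carrier glued" "b \<in> carrier glued"
    then obtain k x y where xy: "x \<in> carrier (V k)" "y \<in> carrier (V k)" "a = q k x" "b = q k y"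
      by (rule glued_cases2)
    interpret star_space "V k" by (rule star_space_V)
    show "w (a \<oplus>\<^bsub>glued\<^esub> b) = w a \<oplus>\<^bsub>W\<^esub> w b"
      using xy by (simp add: w glued_add unital_linear_add[OF \<psi>'])
  next
    interpret aou_space "V 0" by (rule aou)
    show "w (ounit glued) = ounit W"
      by (simp add: glued_ounit[of 0] w unital_linear_ounit[OF \<psi>'])
  qed
  moreover have "w a \<in> pcone W" if a: "a \<in> pcone glued" for a
  proof -
    have "a \<in> carrier glued" using a by (rule glued_pcone_carrier)
    then obtain k x where x: "x \<in> carrier (V k)" "a = q k x" by (rule glued_cases)
    then show ?thesis using a \<psi>[of k] by (simp add: w glued_pcone unital_positive_def)
  qed
  ultimately have "mediates unital_positive V glued q W \<psi> w"
    by (simp add: mediates_def unital_positive_def w)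
  then show ?thesis by blast
qed

end

section \<open>Consequences of the universal property\<close>

lemma inductive_limit_mediator:
  assumes "inductive_limit obj mor A \<alpha> L \<iota>" "cocone obj mor A \<alpha> W \<psi>"
  obtains u where "mediates mor A L \<iota> W \<psi> u"
  using assms unfolding inductive_limit_def by blast

lemma inductive_limit_unique:
  assumes "inductive_limit obj mor A \<alpha> L \<iota>" "cocone obj mor A \<alpha> W \<psi>"
    "mediates mor A L \<iota> W \<psi> u" "mediates mor A L \<iota> W \<psi> u'" "x \<in> carrier L"
  shows "u x = u' x"
  using assms unfolding inductive_limit_def by metis

text \<open>Both \<open>f\<close> and the identity mediate from the limit cocone to itself.\<close>

lemma inductive_limit_endo:
  assumes lim: "inductive_limit obj mor A \<alpha> L \<iota>"
    and "mor L L (\<lambda>x. x)" "mor L L f" "\<And>k x. x \<in> carrier (A k) \<Longrightarrow> f (\<iota> k x) = \<iota> k x"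
    and x: "x \<in> carrier L"
  shows "f x = x"
proof (rule inductive_limit_unique[OF lim _ _ _ x])
  show "cocone obj mor A \<alpha> L \<iota>" using lim by (simp add: inductive_limit_def)
qed (use assms in \<open>auto simp: mediates_def\<close>)

lemma unital_positive_id: "unital_positive V V (\<lambda>x. x)"
  by (simp add: unital_positive_def unital_linear_iff)

lemma ucp_id: "ucp A A (\<lambda>x. x)"
proof -
  have "map_mat (\<lambda>x. x) M = M" for M :: "'a mat" by (rule eq_matI) auto
  then show ?thesis by (simp add: ucp_def unital_linear_iff)
qed

context embedding_system
begin

context
  fixes L \<iota>
  assumes limit: "inductive_limit aou_space unital_positive V \<phi> L \<iota>"
begin

lemma limit_cocone: "cocone aou_space unital_positive V \<phi> L \<iota>"
  using limit by (simp add: inductive_limit_def)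

lemma limit_aou: "aou_space L"
  and limit_map: "unital_positive (V k) L (\<iota> k)"
  and limit_Suc: "x \<in> carrier (V k) \<Longrightarrow> \<iota> (Suc k) (\<phi> k x) = \<iota> k x"
  using limit_cocone by (auto simp: cocone_def)

lemma limit_map_linear: "unital_linear (V k) L (\<iota> k)"
  using limit_map by (simp add: unital_positive_def)

text \<open>Comparison with the glued limit shows that an abstract limit has no other elements and no
  other positive elements than those of the \<open>V k\<close>.\<close>

lemma limit_surj: "x \<in> carrier L \<Longrightarrow> \<exists>k. x \<in> \<iota> k ` carrier (V k)"
  and limit_embedding: "unital_order_embedding (V k) L (\<iota> k)"
proof -
  obtain q where "embedding_charts V \<phi> q" using ex_charts by blast
  then interpret embedding_charts V \<phi> q .
  obtain u where u: "mediates unital_positive V L \<iota> glued q u"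
    using inductive_limit_mediator[OF limit cocone_glued] .
  then have u': "unital_positive L glued u" "\<And>k x. x \<in> carrier (V k) \<Longrightarrow> u (\<iota> k x) = q k x"
    by (auto simp: mediates_def)
  obtain w where "mediates unital_positive V glued q L \<iota> w"
    using ex_mediator[OF limit_cocone] by blast
  then have w: "unital_positive glued L w" "\<And>k x. x \<in> carrier (V k) \<Longrightarrow> w (q k x) = \<iota> k x"
    by (auto simp: mediates_def)
  show "\<exists>k. x \<in> \<iota> k ` carrier (V k)" if x: "x \<in> carrier L"
  proof -
    \<comment> \<open>The composite is an endomorphism of \<open>L\<close> over its cocone, hence
      the identity; so a representative of \<open>u x\<close> in the union also represents
      \<open>x\<close>.\<close>
    have "w (u x) = x"
      by (rule inductive_limit_endo[where f = "\<lambda>x. w (u x)", OF limit unital_positive_id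
            unital_positive_comp[OF u'(1) w(1)] _ x]) (simp add: u' w)
    moreover have "u x \<in> carrier glued"
      using u'(1) x by (auto simp: unital_positive_def unital_linear_closed)
    then obtain k y where "y \<in> carrier (V k)" "u x = q k y" by (rule glued_cases)
    ultimately have "x = \<iota> k y" by (metis w(2))
    then show ?thesis using \<open>y \<in> carrier (V k)\<close> by blast
  qed
  show "unital_order_embedding (V k) L (\<iota> k)"
    unfolding unital_order_embedding_def
  proof (intro conjI ballI)
    \<comment> \<open>\<open>u\<close> after \<open>\<iota> k\<close> is the chart
      \<open>q k\<close>, which is injective.\<close>
    show "inj_on (\<iota> k) (carrier (V k))"
      by (rule inj_on_imageI2[of u]) (use q_inj[of k] u'(2) in \<open>simp add: inj_on_def\<close>)
    fix x assume x: "x \<in> carrier (V k)"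
    show "x \<in> pcone (V k) \<longleftrightarrow> \<iota> k x \<in> pcone L"
    proof
      \<comment> \<open>The positive map \<open>u\<close> sends this to \<open>q k x\<close>, and
        the cone of the union has no further positive elements from \<open>V k\<close>.\<close>
      assume "\<iota> k x \<in> pcone L"
      then have "q k x \<in> pcone glued" using u' x by (metis unital_positive_def)
      then show "x \<in> pcone (V k)" using x by (simp add: glued_pcone)
    qed (use limit_map[of k] in \<open>simp add: unital_positive_def\<close>)
  qed (rule limit_map_linear)
qed

lemma limit_range_mono:
  assumes "k \<le> l"
  shows "\<iota> k ` carrier (V k) \<subseteq> \<iota> l ` carrier (V l)"
  using assms
proof (rule lift_Suc_mono_le[rotated])
  fix k
  have "unital_linear (V k) (V (Suc k)) (\<phi> k)"
    using embedding by (simp add: unital_order_embedding_def)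
  then have "\<iota> k x \<in> \<iota> (Suc k) ` carrier (V (Suc k))" if "x \<in> carrier (V k)" for x
    using that limit_Suc[OF that] by (metis imageI unital_linear_closed)
  then show "\<iota> k ` carrier (V k) \<subseteq> \<iota> (Suc k) ` carrier (V (Suc k))" by blast
qed

lemma limit_finite_level:
  "\<lbrakk>finite X; X \<subseteq> carrier L\<rbrakk> \<Longrightarrow> \<exists>k. X \<subseteq> \<iota> k ` carrier (V k)"
proof (induction X rule: finite_induct)
  case (insert x X)
  then obtain k l where "X \<subseteq> \<iota> k ` carrier (V k)" "x \<in> \<iota> l ` carrier (V l)"
    using limit_surj[of x] by auto
  then have "insert x X \<subseteq> \<iota> (max k l) ` carrier (V (max k l))"
    using limit_range_mono[of k "max k l"] limit_range_mono[of l "max k l"] by auto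
  then show ?case by blast
qed simp

lemma limit_mat_level:
  assumes M: "M \<in> mat_over L n"
  obtains k N where "N \<in> mat_over (V k) n" "M = map_mat (\<iota> k) N"
proof -
  have "elements_mat M \<subseteq> carrier L" using M by (simp add: mat_over_def)
  then obtain k where k: "elements_mat M \<subseteq> \<iota> k ` carrier (V k)"
    using limit_finite_level[of "elements_mat M"] by (auto simp: elements_mat_def)
  have entry: "M $$ (i, j) \<in> \<iota> k ` carrier (V k)" if "i < n" "j < n" for i j
    using k M that by (intro subsetD[OF k] elements_matI) (auto simp: mat_over_def)
  let ?N = "map_mat (inv_into (carrier (V k)) (\<iota> k)) M"
  have "?N \<in> mat_over (V k) n"
    using M entry by (auto simp: mat_over_iff intro!: inv_into_into)
  moreover have "M = map_mat (\<iota> k) ?N"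
    using M entry by (intro eq_matI) (auto simp: mat_over_dim f_inv_into_f)
  ultimately show ?thesis by (rule that)
qed

text \<open>The level \<open>k\<close> is found from the finitely many entries before any form is
  tested, so it does not depend on \<open>c\<close>; then \<open>\<iota> k\<close> reflects
  positivity of every form at once.\<close>

lemma limit_OMIN_mcone:
  assumes M: "M \<in> mcone (OMIN L) n"
  obtains k N where "N \<in> mcone (OMIN (V k)) n" "M = map_mat (\<iota> k) N"
proof -
  interpret L: aou_space L by (rule limit_aou)
  have M': "M \<in> mat_over L n" "\<And>c. sesq L n M c c \<in> pcone L" using M by (auto simp: mcone_OMIN)
  obtain k N where N: "N \<in> mat_over (V k) n" "M = map_mat (\<iota> k) N"
    using limit_mat_level[OF M'(1)] .
  interpret k: aou_space "V k" by (rule aou)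
  have "sesq (V k) n N c c \<in> pcone (V k)" for c
  proof -
    have "\<iota> k (sesq (V k) n N c c) = sesq L n M c c"
      unfolding N(2)
      by (rule unital_linear_sesq[OF k.star_space_axioms L.star_space_axioms limit_map_linear N(1)])
    then show ?thesis
      using M'(2)[of c] limit_embedding[of k] N(1) by (simp add: unital_order_embedding_def)
  qed
  then show ?thesis using N by (intro that[of N k]) (auto simp: mcone_OMIN)
qed

end

end

lemma unital_linear_OMIN_dom [simp]: "unital_linear (OMIN V) W f \<longleftrightarrow> unital_linear V W f"
  by (simp add: unital_linear_iff)

lemma unital_linear_OMIN_cod [simp]: "unital_linear V (OMIN W) f \<longleftrightarrow> unital_linear V W f"
  by (simp add: unital_linear_iff)

lemma ucp_OMIN:
  assumes "aou_space V" "aou_space W" "unital_positive V W f"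
  shows "ucp (OMIN V) (OMIN W) f"
proof -
  interpret V: aou_space V by fact
  interpret W: aou_space W by fact
  have f: "unital_linear V W f" using assms(3) by (simp add: unital_positive_def)
  have "sesq W n (map_mat f M) c c \<in> pcone W" if "M \<in> mcone (OMIN V) n" for n M c
    using that assms(3) unital_linear_sesq[OF V.star_space_axioms W.star_space_axioms f, of M n c c]
    unfolding mcone_OMIN unital_positive_def by metis
  moreover have "map_mat f M \<in> mat_over W n" if "M \<in> mcone (OMIN V) n" for n M
    using that unital_linear_closed[OF f] by (intro map_mat_mat_over[of M V]) (auto simp: mcone_OMIN)
  ultimately show ?thesis using f by (simp add: ucp_def mcone_OMIN[of _ W])
qed

section \<open>The order unit space underlying an operator system\<close>

text \<open>The forgetful passage from operator systems to AOU spaces, with \<open>A\<close>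
  identified with the 1 by 1 matrices over it. It makes an operator system an admissible target for
  the universal property of \<open>L\<close>.\<close>

definition level_one :: "'a op_system \<Rightarrow> 'a aou_space" where
  "level_one A =
     \<lparr>carrier = carrier A, mult = mult A, one = one A, zero = zero A, add = add A,
      smult = smult A, star = star A, ounit = ounit A,
      pcone = {x \<in> carrier A. mat 1 1 (\<lambda>_. x) \<in> mcone A 1}\<rparr>"

lemma level_one_simps [simp]:
  "carrier (level_one A) = carrier A" "zero (level_one A) = zero A" "add (level_one A) = add A"
  "smult (level_one A) = smult A" "star (level_one A) = star A" "ounit (level_one A) = ounit A"
  by (simp_all add: level_one_def)

lemma pcone_level_one: "x \<in> pcone (level_one A) \<longleftrightarrow> x \<in> carrier A \<and> mat 1 1 (\<lambda>_. x) \<in> mcone A 1"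
  by (simp add: level_one_def)

lemma hermitian_level_one: "hermitian (level_one A) = hermitian A"
  by (simp add: hermitian_def)

lemma unital_linear_level_one [simp]: "unital_linear V (level_one A) f \<longleftrightarrow> unital_linear V A f"
  by (simp add: unital_linear_iff)

context op_system
begin

lemma mcone_mat_over: "\<lbrakk>n > 0; M \<in> mcone A n\<rbrakk> \<Longrightarrow> M \<in> mat_over A n"
  using aou_space.pcone_carrier[OF levels[of n], of M] by simp

text \<open>\<open>?J\<close> identifies \<open>A\<close> with the first matrix level, compatibly
  with operations, involution, unit and cone, and the axioms are pulled back along it.\<close>

lemma aou_space_level_one: "aou_space (level_one A)"
proof -
  let ?J = "\<lambda>x. mat 1 1 (\<lambda>_. x)"
  let ?M = "matrix_level A 1"
  interpret M: aou_space ?M by (rule levels) simp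
  have J_add: "?J (x \<oplus> y) = ?J x \<oplus>\<^bsub>?M\<^esub> ?J y" for x y by (auto intro!: eq_matI)
  have J_smult: "?J (c \<odot>\<^bsub>A\<^esub> x) = c \<odot>\<^bsub>?M\<^esub> ?J x" for c x by (auto intro!: eq_matI)
  have J_ounit: "?J (ounit A) = ounit ?M" by (auto intro!: eq_matI)
  have J_pcone: "x \<in> pcone (level_one A) \<longleftrightarrow> ?J x \<in> pcone ?M" for x
    using mcone_mat_over[of 1 "?J x"] by (auto simp: pcone_level_one mat_over_iff)
  have J_eq: "x = y" if "?J x = ?J y" for x y
    using arg_cong[OF that, of "\<lambda>M. M $$ (0, 0)"] by simp
  have J_hermitian: "?J x \<in> hermitian ?M \<longleftrightarrow> x \<in> hermitian A" for x
  proof -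
    have "star ?M (?J x) = ?J (star A x)" by (auto intro!: eq_matI)
    then show ?thesis using J_eq by (auto simp: hermitian_def mat_over_iff simp del: matrix_level_simps(5))
  qed
  show ?thesis
  proof (rule aou_spaceI)
    show "star_space (level_one A)" by (rule star_space_cong[OF star_space_axioms]) simp_all
    show "pcone (level_one A) \<subseteq> hermitian (level_one A)"
      using M.pcone_hermitian J_pcone J_hermitian unfolding hermitian_level_one by blast
    show "ounit (level_one A) \<in> pcone (level_one A)"
      using M.ounit_pcone unfolding J_pcone by (simp only: J_ounit level_one_simps)
  next
    fix x y assume "x \<in> pcone (level_one A)" "y \<in> pcone (level_one A)"
    then show "x \<oplus>\<^bsub>level_one A\<^esub> y \<in> pcone (level_one A)"
      unfolding J_pcone level_one_simps J_add by (rule M.pcone_add)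
  next
    fix r :: real and x assume "0 \<le> r" "x \<in> pcone (level_one A)"
    then show "complex_of_real r \<odot>\<^bsub>level_one A\<^esub> x \<in> pcone (level_one A)"
      unfolding J_pcone level_one_simps J_smult by (rule M.pcone_smult)
  next
    fix x assume "x \<in> pcone (level_one A)" "(-1) \<odot>\<^bsub>level_one A\<^esub> x \<in> pcone (level_one A)"
    then have "?J x = \<zero>\<^bsub>?M\<^esub>"
      unfolding J_pcone level_one_simps J_smult by (rule M.pcone_antisym)
    then show "x = \<zero>\<^bsub>level_one A\<^esub>" using J_eq by simp
  next
    fix x assume "x \<in> hermitian (level_one A)"
    then show "\<exists>r>0. complex_of_real r \<odot>\<^bsub>level_one A\<^esub> ounit (level_one A) \<oplus>\<^bsub>level_one A\<^esub>
        (-1) \<odot>\<^bsub>level_one A\<^esub> x \<in> pcone (level_one A)"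
      unfolding J_pcone hermitian_level_one level_one_simps J_add J_smult J_ounit J_hermitian[symmetric]
      by (rule M.order_unit_add)
  next
    fix x assume "x \<in> hermitian (level_one A)"
      "\<And>r. r > 0 \<Longrightarrow> complex_of_real r \<odot>\<^bsub>level_one A\<^esub> ounit (level_one A) \<oplus>\<^bsub>level_one A\<^esub> x
        \<in> pcone (level_one A)"
    then show "x \<in> pcone (level_one A)"
      unfolding J_pcone hermitian_level_one level_one_simps J_add J_smult J_ounit J_hermitian[symmetric]
      by (rule M.archimedeanI)
  qed
qed

end

text \<open>The form of the 1 by 1 matrix of \<open>x\<close> takes only nonnegative multiples of
  \<open>x\<close> as values, so a positive \<open>x\<close> yields a matrix in the minimal cone,
  and complete positivity at size 1 makes \<open>f x\<close> positive.\<close>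

lemma unital_positive_level_one:
  assumes "aou_space V" "ucp (OMIN V) A f"
  shows "unital_positive V (level_one A) f"
proof -
  interpret aou_space V by fact
  have f: "unital_linear V A f" using assms(2) by (simp add: ucp_def)
  have "f x \<in> pcone (level_one A)" if x: "x \<in> pcone V" for x
  proof -
    have "sesq V 1 (mat 1 1 (\<lambda>_. x)) c c = complex_of_real ((cmod (c 0))\<^sup>2) \<odot>\<^bsub>V\<^esub> x" for c
    proof -
      have "{..<1} \<times> {..<1} = {(0 :: nat, 0 :: nat)}" by auto
      then show ?thesis
        using pcone_carrier[OF x] by (simp add: sesq_def complex_norm_square mult.commute del: of_real_power)
    qed
    then have "mat 1 1 (\<lambda>_. x) \<in> mcone (OMIN V) 1"
      using x by (auto simp: mcone_OMIN pcone_carrier pcone_smult simp del: of_real_power)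
    then have "map_mat f (mat 1 1 (\<lambda>_. x)) \<in> mcone A 1"
      using assms(2) by (simp add: ucp_def)
    moreover have "map_mat f (mat 1 1 (\<lambda>_. x)) = mat 1 1 (\<lambda>_. f x)" by (auto intro!: eq_matI)
    ultimately show ?thesis
      using unital_linear_closed[OF f pcone_carrier[OF x]] by (simp add: pcone_level_one)
  qed
  then show ?thesis using f by (simp add: unital_positive_def)
qed

theorem theorem4p20:
  fixes V :: "nat \<Rightarrow> 'a aou_space" and \<phi> :: "nat \<Rightarrow> 'a \<Rightarrow> 'a"
    and L :: "'a aou_space" and \<iota> :: "nat \<Rightarrow> 'a \<Rightarrow> 'a"
    and S :: "'a op_system" and \<sigma> :: "nat \<Rightarrow> 'a \<Rightarrow> 'a"
  assumes system: "inductive_system aou_space unital_positive V \<phi>"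
    and embedding: "\<And>k. unital_order_embedding (V k) (V (Suc k)) (\<phi> k)"
    and limit_AOU: "inductive_limit aou_space unital_positive V \<phi> L \<iota>"
    and limit_OS: "inductive_limit op_system ucp (\<lambda>k. OMIN (V k)) \<phi> S \<sigma>"
  shows "unitally_completely_order_isomorphic (OMIN L) S"
proof -
  interpret embedding_system V \<phi>
    by (rule embedding_system.intro) (use system in \<open>simp add: inductive_system_def\<close>, rule embedding)
  interpret L: aou_space L by (rule limit_aou[OF limit_AOU])
  have \<sigma>: "cocone op_system ucp (\<lambda>k. OMIN (V k)) \<phi> S \<sigma>"
    using limit_OS by (simp add: inductive_limit_def)
  interpret S: op_system S using \<sigma> by (simp add: cocone_def)
  have \<sigma>_ucp: "ucp (OMIN (V k)) S (\<sigma> k)" for k using \<sigma> by (simp add: cocone_def)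
  have \<iota>: "cocone op_system ucp (\<lambda>k. OMIN (V k)) \<phi> (OMIN L) \<iota>"
    using limit_map[OF limit_AOU] limit_Suc[OF limit_AOU]
    by (simp add: cocone_def L.op_system_OMIN ucp_OMIN aou L.aou_space_axioms)
  \<comment> \<open>At the first matrix level \<open>\<sigma>\<close> is a cocone of positive maps,
    so the universal property of \<open>L\<close> supplies \<open>v\<close>, a priori only
    positive.\<close>
  have "cocone aou_space unital_positive V \<phi> (level_one S) \<sigma>"
    using \<sigma> by (simp add: cocone_def S.aou_space_level_one unital_positive_level_one aou)
  then obtain v where v: "mediates unital_positive V L \<iota> (level_one S) \<sigma> v"
    by (rule inductive_limit_mediator[OF limit_AOU])
  then have v_\<iota>: "v (\<iota> k x) = \<sigma> k x" if "x \<in> carrier (V k)" for k x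
    using that by (simp add: mediates_def)
  have v_linear: "unital_linear L S v" using v by (simp add: mediates_def unital_positive_def)
  have v_ucp: "ucp (OMIN L) S v"
    unfolding ucp_def
  proof (intro conjI allI impI ballI)
    show "unital_linear (OMIN L) S v" using v_linear by simp
    fix n :: nat and M assume n: "n > 0" and M: "M \<in> mcone (OMIN L) n"
    obtain k N where N: "N \<in> mcone (OMIN (V k)) n" "M = map_mat (\<iota> k) N"
      using limit_OMIN_mcone[OF limit_AOU M] .
    have "map_mat v M = map_mat (\<sigma> k) N"
      unfolding N(2) map_mat_map_mat
      by (rule map_mat_cong_mat_over[of _ "V k" n]) (use N(1) v_\<iota> in \<open>auto simp: mcone_OMIN\<close>)
    then show "map_mat v M \<in> mcone S n" using \<sigma>_ucp[of k] N(1) n by (simp add: ucp_def)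
  qed
  obtain u where u: "mediates ucp (\<lambda>k. OMIN (V k)) S \<sigma> (OMIN L) \<iota> u"
    using inductive_limit_mediator[OF limit_OS \<iota>] .
  then have u_ucp: "ucp S (OMIN L) u" and u_\<sigma>: "\<And>k x. x \<in> carrier (V k) \<Longrightarrow> u (\<sigma> k x) = \<iota> k x"
    by (auto simp: mediates_def)
  have u_linear: "unital_linear S L u" using u_ucp by (simp add: ucp_def)
  \<comment> \<open>This composite is an endomorphism of \<open>S\<close> over its cocone. No
    description of the elements of \<open>S\<close> is at hand, so uniqueness of mediating maps
    decides.\<close>
  have vu: "v (u y) = y" if "y \<in> carrier S" for y
    by (rule inductive_limit_endo[where f = "\<lambda>x. v (u x)", OF limit_OS ucp_id ucp_comp[OF u_ucp v_ucp] _ that])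
      (simp add: u_\<sigma> v_\<iota>)
  \<comment> \<open>Here the ranges of the \<open>\<iota> k\<close> exhaust \<open>L\<close>, and on
    them \<open>u\<close> undoes \<open>v\<close>.\<close>
  have uv: "u (v x) = x" if "x \<in> carrier L" for x
    using limit_surj[OF limit_AOU that] by (auto simp: u_\<sigma> v_\<iota>)
  have bij: "bij_betw v (carrier L) (carrier S)"
    by (rule bij_betw_byWitness[of _ u])
      (auto simp: uv vu unital_linear_closed[OF v_linear] unital_linear_closed[OF u_linear])
  have inv: "inv_into (carrier L) v y = u y" if "y \<in> carrier S" for y
    using inv_into_f_eq[OF bij_betw_imp_inj_on[OF bij], of "u y" y] that
    by (simp add: vu unital_linear_closed[OF u_linear])
  \<comment> \<open>The inverse is known to agree with \<open>u\<close> only on the carrier of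
    \<open>S\<close>; this suffices because matrices in the cones of \<open>S\<close> have their
    entries there.\<close>
  have "ucp S (OMIN L) (inv_into (carrier L) v)"
    unfolding ucp_def
  proof (intro conjI allI impI ballI)
    show "unital_linear S (OMIN L) (inv_into (carrier L) v)"
      using unital_linear_cong[OF S.star_space_axioms S.ounit_closed u_linear] by (simp add: inv)
    fix n :: nat and M assume n: "n > 0" and M: "M \<in> mcone S n"
    have "map_mat (inv_into (carrier L) v) M = map_mat u M"
      by (rule map_mat_cong_mat_over[OF S.mcone_mat_over[OF n M]]) (rule inv)
    then show "map_mat (inv_into (carrier L) v) M \<in> mcone (OMIN L) n"
      using u_ucp n M by (simp add: ucp_def)
  qed
  then show ?thesis
    using bij v_ucp unfolding unitally_completely_order_isomorphic_def by auto
qed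

end
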